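(* Let $X$ be a separable almost Daugavet space, let $J$ be an $L$-summand of $X$ and let $\widehat{J}$ be the complementary $L$-summand (i.e., $X=J\oplus_1\widehat{J}$). Then $J$ or $\widehat{J}$ has the almost Daugavet property.
   Context: Banach spaces are over the scalar field $\mathbb{K}\in\{\mathbb{R},\mathbb{C}\}$. $X=J\oplus_1\widehat{J}$ means that $J,\widehat{J}$ are closed subspaces of $X$ such that every $x\in X$ has a unique decomposition $x=j+\widehat{j}$ with $j\in J$, $\widehat{j}\in\widehat{J}$, and $\|x\|=\|j\|+\|\widehat{j}\|$; in this case $J$ is called an $L$-summand and $\widehat{J}$ its complementary $L$-summand. For a Banach space $X$, $X^*$ denotes its dual, and $S_Y$ denotes the unit sphere of a normed space $Y$. A linear subspace $Y\subset X^*$ is called norming if $\sup_{y^*\in S_Y}|y^*(x)|=\|x\|$ for every $x\in X$. For $x\in X$ and $y^*\in X^*$, $y^*\otimes x$ denotes the operator $X\to X$, $z\mapsto y^*(z)x$. $X$ has the Daugavet property with respect to a subspace $Y\subset X^*$ if $\|\operatorname{Id}+T\|=1+\|T\|$ holds for every operator $T=y^*\otimes x$ with $x\in X$ and $y^*\in Y$ (the zero operator is included here, so the space $\{0\}$ does not qualify; for nonzero spaces including it makes no difference). $X$ is called an almost Daugavet space (or is said to have the almost Daugavet property) if it has the Daugavet property with respect to some norming subspace $Y\subset X^*$. *)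

theory Defs
  imports "HOL-Analysis.Analysis"
begin

text \<open>
  Everything below is relative to a scalar multiplication \<open>smul\<close> by elements of a field \<open>'k\<close>. It is
  used for \<open>'k = real\<close> with \<open>smul = (*\<^sub>R)\<close>, and for \<open>'k = complex\<close> with a given complex scalar
  multiplication satisfying \<open>normed_space_over\<close>.
\<close>

locale normed_space_over = vector_space smul
  for smul :: "'k::real_normed_field \<Rightarrow> 'a::real_normed_vector \<Rightarrow> 'a" +
  assumes norm_scale: "norm (smul c x) = norm c * norm x"
    and scale_of_real: "smul (of_real r) x = r *\<^sub>R x"

lemma normed_space_over_scaleR:
  "normed_space_over (scaleR :: real \<Rightarrow> 'a::real_normed_vector \<Rightarrow> 'a)"
  by unfold_locales (simp_all add: algebra_simps)

text \<open>
  A subspace \<open>V\<close> is regarded as a normed space in its own right. Accordingly the operator norm is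
  taken over \<open>V\<close> only; it is 0 on the zero space.
\<close>

definition onorm_on :: "'a::real_normed_vector set \<Rightarrow> ('a \<Rightarrow> 'b::real_normed_vector) \<Rightarrow> real" where
  "onorm_on V T = (SUP x\<in>V. norm (T x) / norm x)"

lemma onorm_on_UNIV: "onorm_on UNIV = onorm"
  by (simp add: fun_eq_iff onorm_on_def onorm_def)

text \<open>
  The dual of \<open>V\<close>: bounded linear functionals on \<open>V\<close>, represented by functions on the ambient type
  that vanish off \<open>V\<close>, so that equality of functions is equality of functionals.
\<close>

definition dual_on ::
    "('k::real_normed_field \<Rightarrow> 'a::real_normed_vector \<Rightarrow> 'a) \<Rightarrow> 'a set \<Rightarrow> ('a \<Rightarrow> 'k) set" where
  "dual_on smul V = {f.
     (\<forall>x\<in>V. \<forall>y\<in>V. f (x + y) = f x + f y) \<and>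
     (\<forall>c. \<forall>x\<in>V. f (smul c x) = c * f x) \<and>
     (\<exists>B. \<forall>x\<in>V. norm (f x) \<le> B * norm x) \<and>
     (\<forall>x. x \<notin> V \<longrightarrow> f x = 0)}"

definition dual_subspace ::
    "('k::real_normed_field \<Rightarrow> 'a::real_normed_vector \<Rightarrow> 'a) \<Rightarrow> 'a set \<Rightarrow> ('a \<Rightarrow> 'k) set \<Rightarrow> bool" where
  "dual_subspace smul V Y \<longleftrightarrow>
     Y \<subseteq> dual_on smul V \<and>
     (\<lambda>x. 0) \<in> Y \<and>
     (\<forall>f\<in>Y. \<forall>g\<in>Y. (\<lambda>x. f x + g x) \<in> Y) \<and>
     (\<forall>c. \<forall>f\<in>Y. (\<lambda>x. c * f x) \<in> Y)"

text \<open>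
  The supremum is taken in \<open>ennreal\<close>, where the supremum of the empty set is 0; this matters only
  when \<open>Y\<close> has empty unit sphere.
\<close>

definition norming_on :: "'a::real_normed_vector set \<Rightarrow> ('a \<Rightarrow> 'k::real_normed_field) set \<Rightarrow> bool" where
  "norming_on V Y \<longleftrightarrow>
     (\<forall>x\<in>V. (SUP f\<in>{f\<in>Y. onorm_on V f = 1}. ennreal (norm (f x))) = ennreal (norm x))"

definition daugavet_wrt ::
    "('k::real_normed_field \<Rightarrow> 'a::real_normed_vector \<Rightarrow> 'a) \<Rightarrow> 'a set \<Rightarrow> ('a \<Rightarrow> 'k) set \<Rightarrow> bool" where
  "daugavet_wrt smul V Y \<longleftrightarrow>
     (\<forall>x\<in>V. \<forall>f\<in>Y.
        onorm_on V (\<lambda>z. z + smul (f z) x) = 1 + onorm_on V (\<lambda>z. smul (f z) x))"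

definition almost_daugavet ::
    "('k::real_normed_field \<Rightarrow> 'a::real_normed_vector \<Rightarrow> 'a) \<Rightarrow> 'a set \<Rightarrow> bool" where
  "almost_daugavet smul V \<longleftrightarrow>
     (\<exists>Y. dual_subspace smul V Y \<and> norming_on V Y \<and> daugavet_wrt smul V Y)"

definition L_decomposition ::
    "('k::real_normed_field \<Rightarrow> 'a::real_normed_vector \<Rightarrow> 'a) \<Rightarrow> 'a set \<Rightarrow> 'a set \<Rightarrow> bool" where
  "L_decomposition smul J J' \<longleftrightarrow>
     module.subspace smul J \<and> closed J \<and>
     module.subspace smul J' \<and> closed J' \<and>
     (\<forall>x. \<exists>!p. p \<in> J \<times> J' \<and> x = fst p + snd p) \<and>
     (\<forall>u\<in>J. \<forall>v\<in>J'. norm (u + v) = norm u + norm v)"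

end

theory Submission
  imports Defs
begin

text \<open>
  The proof goes through a geometric property that does not mention functionals. Call \<open>V\<close> thick if for
  every finite \<open>F \<subseteq> V\<close> and every \<open>\<epsilon> > 0\<close> some \<open>e\<close> in the unit ball of \<open>V\<close> satisfies
  \<open>\<parallel>x + e\<parallel> \<ge> \<parallel>x\<parallel> + 1 - \<epsilon>\<close> for all \<open>x \<in> F\<close>.

  An almost Daugavet space is thick (\<open>almost_daugavet_imp_thick\<close>). Let \<open>u \<in> Y\<close> have norm 1. The Daugavet
  equation for \<open>u \<otimes> x\<close> and the norming property of \<open>Y\<close> provide a second norm-one functional \<open>z \<in> Y\<close> that
  is almost \<open>\<parallel>x\<parallel>\<close> at \<open>x\<close> and almost 1 at some point of the ball where \<open>u\<close> is almost 1 as well. A thin slice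
  of the ball cut off by \<open>z + u\<close> is contained in any prescribed slice of \<open>u\<close>, and its points \<open>w\<close> satisfy
  \<open>\<parallel>x + w\<parallel> \<ge> z (x + w) \<approx> \<parallel>x\<parallel> + 1\<close>. Shrinking slices in this way takes care of the elements of \<open>F\<close> one
  after another.

  If \<open>X = J \<oplus>\<^sub>1 J'\<close> is thick, then \<open>J\<close> or \<open>J'\<close> is thick (\<open>thick_L_summand\<close>). Split \<open>e = u + v\<close> along the
  decomposition. Since the norm is additive, \<open>u\<close> and \<open>v\<close> add up with \<open>F \<subseteq> J\<close> and \<open>G \<subseteq> J'\<close> almost as in an
  l1-sum, and one of them is not short. If \<open>J\<close> fails to be thick, some \<open>F\<close> forces \<open>u\<close> to be short, hence
  \<open>v\<close> to be long, for every \<open>G\<close>.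

  A separable thick subspace is almost Daugavet (\<open>separable_thick_imp_almost_daugavet\<close>); this is the
  substantial part. Compactness of balls in finite-dimensional spaces upgrades thickness to a sequence
  \<open>e\<^sub>n\<close> in the ball that is almost l1-orthogonal to growing finite-dimensional subspaces \<open>S\<^sub>n\<close> whose union is
  dense. Fix a dense sequence and let \<open>u\<^sub>n \<in> S\<^sub>n\<close> run through its normalized terms, each taken infinitely often.
  Put \<open>Y = {f. f (e\<^sub>n) = f (u\<^sub>n) for almost all n}\<close>. This works for two reasons.

  \<^item> For \<open>f \<in> Y\<close> the operator \<open>Id + f \<otimes> x\<close> maps \<open>e\<^sub>n\<close> to \<open>e\<^sub>n + f (u\<^sub>n) x\<close>. Along the infinitely many \<open>n\<close>
    with the same value \<open>u\<^sub>n\<close>, the second summand is fixed, so the norm tends to \<open>1 + \<bar>f (u\<^sub>n)\<bar> \<parallel>x\<parallel>\<close>. The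
    supremum over the values of \<open>u\<^sub>n\<close> is \<open>1 + \<parallel>f\<parallel> \<parallel>x\<parallel>\<close>.

  \<^item> \<open>Y\<close> is norming: all functionals that vanish on \<open>T\<^sub>N = span {e\<^sub>n - u\<^sub>n | n \<ge> N}\<close> are in \<open>Y\<close>, and by the
    Hahn--Banach theorem they detect the distance of \<open>x\<close> to \<open>T\<^sub>N\<close>. Peeling off one term at a time, adding
    \<open>c (e\<^sub>n - u\<^sub>n)\<close> to \<open>y \<in> S\<^sub>n\<close> gives a norm of almost \<open>\<parallel>y - c u\<^sub>n\<parallel> + \<bar>c\<bar> \<ge> \<parallel>y\<parallel>\<close>, because \<open>\<parallel>u\<^sub>n\<parallel> \<le> 1\<close>. So the
    distance is almost \<open>\<parallel>x\<parallel>\<close> once \<open>N\<close> is large (\<open>tail_distance\<close>).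

  The argument is the same for real and complex scalars except in the Hahn--Banach theorem. The
  locale \<open>hahn_banach_space\<close> therefore fixes a field that is also a Euclidean space and assumes the
  extension property; its inner product \<open>1 \<bullet> c\<close> is the real part of \<open>c\<close>.
\<close>

section \<open>The Hahn--Banach theorem for seminorms\<close>

text \<open>
  The second condition is stated as an inequality, because this form passes to infima directly. Equality
  follows: see \<open>sublinear_scaleR\<close>.
\<close>

definition sublinear :: "('a::real_vector \<Rightarrow> real) \<Rightarrow> bool" where
  "sublinear q \<longleftrightarrow> (\<forall>x y. q (x + y) \<le> q x + q y) \<and> (\<forall>r\<ge>0. \<forall>x. q (r *\<^sub>R x) \<le> r * q x)"

lemma sublinearD:
  assumes "sublinear q"
  shows "q (x + y) \<le> q x + q y" and "0 \<le> r \<Longrightarrow> q (r *\<^sub>R x) \<le> r * q x"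
  using assms by (auto simp: sublinear_def)

lemma sublinear_zero:
  assumes "sublinear q"
  shows "q 0 = 0"
  using sublinearD(1)[OF assms, of 0 0] sublinearD(2)[OF assms, of 0 0] by simp

lemma sublinear_scaleR:
  assumes q: "sublinear q" and r: "0 \<le> r"
  shows "q (r *\<^sub>R x) = r * q x"
proof (cases "r = 0")
  case True
  then show ?thesis using sublinear_zero[OF q] by simp
next
  case False
  with r have "r > 0" by simp
  have "q ((1 / r) *\<^sub>R (r *\<^sub>R x)) \<le> (1 / r) * q (r *\<^sub>R x)"
    using \<open>r > 0\<close> by (intro sublinearD(2)[OF q]) auto
  then have "r * q x \<le> q (r *\<^sub>R x)"
    using \<open>r > 0\<close> by (simp add: field_simps)
  with sublinearD(2)[OF q r, of x] show ?thesis by simp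
qed

lemma sublinear_ge_neg:
  assumes "sublinear q"
  shows "- q (- x) \<le> q x"
  using sublinearD(1)[OF assms, of x "- x"] sublinear_zero[OF assms] by simp

text \<open>
  The largest sublinear functional below \<open>q\<close> whose value at \<open>- x\<close> is at most \<open>- q x\<close>: a linear functional
  below \<open>q\<close> agrees with \<open>q\<close> at \<open>x\<close> exactly if it lies below \<open>tilt q x\<close>.
\<close>

definition tilt :: "('a::real_vector \<Rightarrow> real) \<Rightarrow> 'a \<Rightarrow> 'a \<Rightarrow> real" where
  "tilt q x z = (INF t\<in>{0..}. q (z + t *\<^sub>R x) - t * q x)"

lemma tilt_le:
  assumes q: "sublinear q" and t: "0 \<le> t"
  shows "tilt q x z \<le> q (z + t *\<^sub>R x) - t * q x"
proof -
  have "bdd_below ((\<lambda>t. q (z + t *\<^sub>R x) - t * q x) ` {0..})"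
  proof (rule bdd_belowI2)
    fix s :: real assume s: "s \<in> {0..}"
    have "q (s *\<^sub>R x) \<le> q (z + s *\<^sub>R x) + q (- z)"
      using sublinearD(1)[OF q, of "z + s *\<^sub>R x" "- z"] by simp
    then show "- q (- z) \<le> q (z + s *\<^sub>R x) - s * q x"
      using sublinear_scaleR[OF q, of s x] s by simp
  qed
  then show ?thesis
    unfolding tilt_def using t by (intro cINF_lower) auto
qed

lemma tilt_greatest:
  assumes "\<And>t. 0 \<le> t \<Longrightarrow> c \<le> q (z + t *\<^sub>R x) - t * q x"
  shows "c \<le> tilt q x z"
  unfolding tilt_def using assms by (intro cINF_greatest) auto

lemma tilt_le_self: "sublinear q \<Longrightarrow> tilt q x z \<le> q z"
  using tilt_le[of q 0 x z] by simp

lemma tilt_at_minus: "sublinear q \<Longrightarrow> tilt q x (- x) \<le> - q x"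
  using tilt_le[of q 1 x "- x"] sublinear_zero[of q] by simp

lemma sublinear_tilt:
  assumes q: "sublinear q"
  shows "sublinear (tilt q x)"
  unfolding sublinear_def
proof (intro conjI allI impI)
  fix y z
  have *: "tilt q x (y + z) \<le> (q (y + s *\<^sub>R x) - s * q x) + (q (z + t *\<^sub>R x) - t * q x)"
    if "0 \<le> s" "0 \<le> t" for s t
  proof -
    have "tilt q x (y + z) \<le> q ((y + z) + (s + t) *\<^sub>R x) - (s + t) * q x"
      using that by (intro tilt_le[OF q]) auto
    moreover have "q ((y + z) + (s + t) *\<^sub>R x) \<le> q (y + s *\<^sub>R x) + q (z + t *\<^sub>R x)"
      using sublinearD(1)[OF q, of "y + s *\<^sub>R x" "z + t *\<^sub>R x"] by (simp add: algebra_simps)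
    ultimately show ?thesis by (simp add: algebra_simps)
  qed
  have "tilt q x (y + z) - (q (z + t *\<^sub>R x) - t * q x) \<le> tilt q x y" if "0 \<le> t" for t
    by (rule tilt_greatest) (use *[OF _ that] in \<open>smt (verit)\<close>)
  then have "tilt q x (y + z) - tilt q x y \<le> tilt q x z"
    by (intro tilt_greatest) (smt (verit))
  then show "tilt q x (y + z) \<le> tilt q x y + tilt q x z" by simp
next
  fix r :: real and z assume r: "0 \<le> r"
  show "tilt q x (r *\<^sub>R z) \<le> r * tilt q x z"
  proof (cases "r = 0")
    case True
    then show ?thesis using tilt_le_self[OF q, of x 0] sublinear_zero[OF q] by simp
  next
    case False
    with r have "r > 0" by simp
    have "tilt q x (r *\<^sub>R z) / r \<le> q (z + t *\<^sub>R x) - t * q x" if t: "0 \<le> t" for t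
    proof -
      have "tilt q x (r *\<^sub>R z) \<le> q (r *\<^sub>R z + (r * t) *\<^sub>R x) - (r * t) * q x"
        using r t by (intro tilt_le[OF q]) auto
      also have "q (r *\<^sub>R z + (r * t) *\<^sub>R x) = r * q (z + t *\<^sub>R x)"
        using sublinear_scaleR[OF q r, of "z + t *\<^sub>R x"] by (simp add: scaleR_add_right)
      finally show ?thesis using \<open>r > 0\<close> by (simp add: field_simps)
    qed
    then have "tilt q x (r *\<^sub>R z) / r \<le> tilt q x z" by (rule tilt_greatest)
    then show ?thesis using \<open>r > 0\<close> by (simp add: field_simps)
  qed
qed

text \<open>
  Minimality forces \<open>tilt q x = q\<close> for every \<open>x\<close>. Evaluated at \<open>- x\<close>, this says that \<open>q\<close> is odd, and an odd
  sublinear functional is additive.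
\<close>

lemma minimal_sublinear_is_linear:
  assumes q: "sublinear q"
    and min: "\<And>q'. sublinear q' \<Longrightarrow> (\<And>z. q' z \<le> q z) \<Longrightarrow> q' = q"
  shows "linear q"
proof -
  have neg: "q (- x) = - q x" for x
  proof -
    have "tilt q x = q" using sublinear_tilt[OF q] tilt_le_self[OF q] by (intro min) auto
    then have "q (- x) \<le> - q x" using tilt_at_minus[OF q, of x] by simp
    with sublinear_ge_neg[OF q, of x] show ?thesis by simp
  qed
  have "q (x + y) = q x + q y" for x y
    using sublinearD(1)[OF q, of x y] sublinearD(1)[OF q, of "x + y" "- y"] by (simp add: neg)
  moreover have "q (r *\<^sub>R x) = r *\<^sub>R q x" for r x
  proof (cases "0 \<le> r")
    case True
    then show ?thesis using sublinear_scaleR[OF q] by simp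
  next
    case False
    then show ?thesis using sublinear_scaleR[OF q, of "- r" "x"] neg[of "r *\<^sub>R x"] by simp
  qed
  ultimately show ?thesis by (intro linearI)
qed

text \<open>
  Zorn's lemma for the reversed pointwise order. The infimum of a chain is finite because every member \<open>q\<close>
  satisfies \<open>q z \<ge> - q (- z) \<ge> - p (- z)\<close>, and it is subadditive because for any two members of a chain the
  smaller one bounds both terms.
\<close>

lemma minimal_sublinear_below:
  assumes p: "sublinear p"
  obtains q where "sublinear q" and "\<And>z. q z \<le> p z"
    and "\<And>q'. sublinear q' \<Longrightarrow> (\<And>z. q' z \<le> q z) \<Longrightarrow> q' = q"
proof -
  define A where "A = {q. sublinear q \<and> q \<le> p}"
  define P :: "('a \<Rightarrow> real) \<Rightarrow> ('a \<Rightarrow> real) \<Rightarrow> bool" where "P = (\<lambda>q q'. q' \<le> q)"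
  have "\<exists>m\<in>A. \<forall>a\<in>A. P m a \<longrightarrow> a = m"
  proof (rule predicate_Zorn)
    show "partial_order_on A (relation_of P A)"
      unfolding P_def
      by (auto simp: partial_order_on_def preorder_on_def relation_of_def refl_on_def trans_def antisym_def)
  next
    fix C assume "C \<in> Chains (relation_of P A)"
    then have sub: "C \<subseteq> A" and chain: "\<And>a b. a \<in> C \<Longrightarrow> b \<in> C \<Longrightarrow> a \<le> b \<or> b \<le> a"
      by (auto simp: Chains_def relation_of_def P_def)
    show "\<exists>u\<in>A. \<forall>a\<in>C. P a u"
    proof (cases "C = {}")
      case True
      then show ?thesis using p by (auto simp: A_def)
    next
      case False
      define m where "m z = (INF q\<in>C. q z)" for z
      have lower: "m z \<le> q z" if "q \<in> C" for q z
      proof -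
        have "- p (- z) \<le> q' z" if "q' \<in> C" for q'
        proof -
          have "sublinear q'" "q' (- z) \<le> p (- z)" using that sub by (auto simp: A_def le_fun_def)
          then show ?thesis using sublinear_ge_neg[of q' z] by simp
        qed
        then have "bdd_below ((\<lambda>q. q z) ` C)" by (rule bdd_belowI2)
        then show ?thesis unfolding m_def using that by (rule cINF_lower)
      qed
      have greatest: "c \<le> m z" if "\<And>q. q \<in> C \<Longrightarrow> c \<le> q z" for c z
        unfolding m_def using False that by (rule cINF_greatest)
      have "sublinear m"
        unfolding sublinear_def
      proof (intro conjI allI impI)
        fix x y
        have *: "m (x + y) \<le> q1 x + q2 y" if q12: "q1 \<in> C" "q2 \<in> C" for q1 q2
        proof -
          obtain q where q: "q \<in> C" "q \<le> q1" "q \<le> q2" using chain[OF q12] q12 by (metis order_refl)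
          have "m (x + y) \<le> q (x + y)" by (rule lower[OF q(1)])
          also have "\<dots> \<le> q x + q y" using q(1) sub by (intro sublinearD(1)) (auto simp: A_def)
          also have "\<dots> \<le> q1 x + q2 y" using q by (intro add_mono) (auto simp: le_fun_def)
          finally show ?thesis .
        qed
        have "m (x + y) - q2 y \<le> m x" if "q2 \<in> C" for q2
          by (rule greatest) (use *[OF _ that] in \<open>smt (verit)\<close>)
        then have "m (x + y) - m x \<le> m y"
          by (intro greatest) (smt (verit))
        then show "m (x + y) \<le> m x + m y" by simp
      next
        fix r :: real and x assume r: "0 \<le> r"
        show "m (r *\<^sub>R x) \<le> r * m x"
        proof (cases "r = 0")
          case True
          obtain q where "q \<in> C" using False by auto
          moreover from this have "q 0 = 0" using sub sublinear_zero by (auto simp: A_def)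
          ultimately show ?thesis using True lower[of q 0] by simp
        next
          case False
          with r have "r > 0" by simp
          have "m (r *\<^sub>R x) / r \<le> q x" if "q \<in> C" for q
          proof -
            have "m (r *\<^sub>R x) \<le> q (r *\<^sub>R x)" by (rule lower[OF that])
            also have "\<dots> \<le> r * q x" using that sub r by (intro sublinearD(2)) (auto simp: A_def)
            finally show ?thesis using \<open>r > 0\<close> by (simp add: field_simps)
          qed
          then have "m (r *\<^sub>R x) / r \<le> m x" by (rule greatest)
          then show ?thesis using \<open>r > 0\<close> by (simp add: field_simps)
        qed
      qed
      moreover have "m \<le> p"
      proof (rule le_funI)
        fix z
        obtain q where "q \<in> C" using False by auto
        then have "m z \<le> q z" "q z \<le> p z" using lower sub by (auto simp: A_def le_fun_def)
        then show "m z \<le> p z" by simp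
      qed
      ultimately show ?thesis using lower by (auto simp: A_def P_def le_fun_def)
    qed
  qed
  then obtain q where q: "q \<in> A" and min: "\<And>a. a \<in> A \<Longrightarrow> a \<le> q \<Longrightarrow> a = q"
    by (auto simp: P_def)
  show thesis
  proof (rule that)
    show "sublinear q" "\<And>z. q z \<le> p z" using q by (auto simp: A_def le_fun_def)
    fix q' assume "sublinear q'" "\<And>z. q' z \<le> q z"
    then have "q' \<le> q" "q' \<in> A" using q by (auto simp: A_def le_fun_def intro: order_trans)
    then show "q' = q" using min by blast
  qed
qed

text \<open>
  Minimizing below \<open>tilt p x\<close> instead of \<open>p\<close> makes the resulting linear functional agree with \<open>p\<close> at \<open>x\<close>.
\<close>

theorem sublinear_hahn_banach:
  assumes p: "sublinear p"
  obtains f where "linear f" and "\<And>z. f z \<le> p z" and "f x = p x"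
proof -
  obtain q where q: "sublinear q" and le: "\<And>z. q z \<le> tilt p x z"
    and min: "\<And>q'. sublinear q' \<Longrightarrow> (\<And>z. q' z \<le> q z) \<Longrightarrow> q' = q"
    using minimal_sublinear_below[OF sublinear_tilt[OF p, of x]] by metis
  have lin: "linear q" by (rule minimal_sublinear_is_linear[OF q min])
  have le_p: "q z \<le> p z" for z using le[of z] tilt_le_self[OF p, of x z] by simp
  have "q (- x) \<le> - p x" using le[of "- x"] tilt_at_minus[OF p, of x] by simp
  then have "q x = p x" using le_p[of x] linear_neg[OF lin, of x] by simp
  with lin le_p show thesis by (rule that)
qed

definition (in normed_space_over) seminorm :: "('a \<Rightarrow> real) \<Rightarrow> bool" where
  "seminorm p \<longleftrightarrow> (\<forall>x y. p (x + y) \<le> p x + p y) \<and> (\<forall>c x. p (smul c x) = norm c * p x)"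

lemma (in normed_space_over) seminorm_imp_sublinear:
  assumes "seminorm p"
  shows "sublinear p"
proof -
  have "p (r *\<^sub>R x) = \<bar>r\<bar> * p x" for r x
    using assms scale_of_real[of r x] by (metis norm_of_real seminorm_def)
  with assms show ?thesis by (auto simp: sublinear_def seminorm_def)
qed

text \<open>
  The interface between the two scalar fields and the rest of the proof. Both fields are Euclidean
  spaces, which gives compactness of bounded closed sets of scalars and a real part.
\<close>

locale hahn_banach_space = normed_space_over smul
  for smul :: "'k::{real_normed_field, euclidean_space} \<Rightarrow> 'a::real_normed_vector \<Rightarrow> 'a" +
  assumes hahn_banach: "seminorm p \<Longrightarrow>
    \<exists>f. (\<forall>x y. f (x + y) = f x + f y) \<and> (\<forall>c x. f (smul c x) = c * f x) \<and>
        (\<forall>x. norm (f x) \<le> p x) \<and> norm (f x0) = p x0"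

lemma hahn_banach_space_scaleR:
  "hahn_banach_space (scaleR :: real \<Rightarrow> 'a::real_normed_vector \<Rightarrow> 'a)"
proof -
  interpret normed_space_over "scaleR :: real \<Rightarrow> 'a \<Rightarrow> 'a" by (rule normed_space_over_scaleR)
  show ?thesis
  proof unfold_locales
    fix p x0 assume p: "seminorm p"
    obtain f where f: "linear f" "\<And>z. f z \<le> p z" "f x0 = p x0"
      using sublinear_hahn_banach[OF seminorm_imp_sublinear[OF p]] by metis
    have "p (- x) = p x" for x
      using p by (metis abs_minus_cancel abs_one mult_1 real_norm_def scaleR_minus1_left seminorm_def)
    then have *: "\<bar>f x\<bar> \<le> p x" for x
      using f(2)[of x] f(2)[of "- x"] linear_neg[OF f(1), of x] by simp
    with f(3) have "\<bar>f x0\<bar> = p x0" using *[of x0] by simp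
    with * show "\<exists>f. (\<forall>x y. f (x + y) = f x + f y) \<and> (\<forall>c x. f (c *\<^sub>R x) = c * f x) \<and>
        (\<forall>x. norm (f x) \<le> p x) \<and> norm (f x0) = p x0"
      by (intro exI[of _ f]) (auto simp: linear_add[OF f(1)] linear_cmul[OF f(1)])
  qed
qed

lemma unimodular_rotation:
  fixes c :: "'k::real_normed_field"
  obtains \<theta> where "norm \<theta> = 1" and "\<theta> * c = of_real (norm c)"
proof (cases "c = 0")
  case True
  then show thesis using that[of 1] by simp
next
  case False
  then show thesis using that[of "of_real (norm c) / c"] by (simp add: norm_divide)
qed

text \<open>
  The real part \<open>f\<close> of a complex functional determines it: \<open>F z = f z - i f (i z)\<close>. Rotating \<open>z\<close> until \<open>F z\<close> is a
  nonnegative real number transfers the bound from \<open>f\<close> to \<open>F\<close>.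
\<close>

lemma hahn_banach_space_complex:
  fixes smul :: "complex \<Rightarrow> 'a::real_normed_vector \<Rightarrow> 'a"
  assumes "normed_space_over smul"
  shows "hahn_banach_space smul"
proof -
  interpret normed_space_over smul by (rule assms)
  show ?thesis
  proof unfold_locales
    fix p x0 assume p: "seminorm p"
    obtain f where f: "linear f" "\<And>z. f z \<le> p z" "f x0 = p x0"
      using sublinear_hahn_banach[OF seminorm_imp_sublinear[OF p]] by metis
    define F where "F z = Complex (f z) (- f (smul \<i> z))" for z
    have f_add: "f (x + y) = f x + f y" and f_scale: "f (smul (of_real r) x) = r * f x" for x y r
      by (simp_all add: linear_add[OF f(1)] scale_of_real linear_cmul[OF f(1)])
    have add: "F (x + y) = F x + F y" for x y
      by (simp add: F_def scale_right_distrib f_add complex_eq_iff)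
    have scale: "F (smul c x) = c * F x" for c x
    proof -
      have c: "smul c y = smul (of_real (Re c)) y + smul (of_real (Im c)) (smul \<i> y)" for y
        by (simp add: scale_left_distrib[symmetric] complex_eq mult.commute)
      have fc: "f (smul c y) = Re c * f y + Im c * f (smul \<i> y)" for y
        by (subst c) (simp add: f_add f_scale del: scale_scale)
      have "f (smul \<i> (smul \<i> x)) = - f x"
        by (simp add: linear_neg[OF f(1)])
      moreover have "smul \<i> (smul c x) = smul c (smul \<i> x)" by (simp add: mult.commute)
      ultimately show ?thesis
        by (simp add: F_def complex_eq_iff fc del: scale_scale)
    qed
    have le: "norm (F x) \<le> p x" for x
    proof -
      obtain \<theta> where \<theta>: "norm \<theta> = 1" "\<theta> * F x = of_real (norm (F x))"
        by (rule unimodular_rotation)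
      have "norm (F x) = Re (F (smul \<theta> x))" by (simp add: scale \<theta>)
      also have "\<dots> = f (smul \<theta> x)" by (simp add: F_def)
      also have "\<dots> \<le> p (smul \<theta> x)" by (rule f(2))
      also have "\<dots> = p x" using p \<theta>(1) by (simp add: seminorm_def)
      finally show ?thesis .
    qed
    moreover have "p x0 \<le> norm (F x0)"
      using complex_Re_le_cmod[of "F x0"] f(3) by (simp add: F_def)
    ultimately show "\<exists>f. (\<forall>x y. f (x + y) = f x + f y) \<and> (\<forall>c x. f (smul c x) = c * f x) \<and>
        (\<forall>x. norm (f x) \<le> p x) \<and> norm (f x0) = p x0"
      using add scale by (intro exI[of _ F]) (auto intro: antisym)
  qed
qed

section \<open>Functionals and operator norms on a subspace\<close>

lemma onorm_on_ge:
  assumes "\<And>x. x \<in> V \<Longrightarrow> norm (T x) \<le> B * norm x" and "x \<in> V"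
  shows "norm (T x) / norm x \<le> onorm_on V T"
proof -
  have "norm (T y) / norm y \<le> \<bar>B\<bar>" if "y \<in> V" for y
  proof (cases "norm y = 0")
    case False
    then have "norm (T y) / norm y \<le> B" using assms(1)[OF that] by (simp add: divide_simps)
    then show ?thesis by simp
  qed simp
  then have "bdd_above ((\<lambda>x. norm (T x) / norm x) ` V)" by (rule bdd_aboveI2)
  then show ?thesis unfolding onorm_on_def using assms(2) by (intro cSUP_upper)
qed

lemma norm_le_onorm_on:
  assumes "\<And>x. x \<in> V \<Longrightarrow> norm (T x) \<le> B * norm x" and "x \<in> V"
  shows "norm (T x) \<le> onorm_on V T * norm x"
proof (cases "x = 0")
  case True
  then show ?thesis using assms(1)[OF assms(2)] by simp
next
  case False
  then show ?thesis using onorm_on_ge[of V T B, OF assms] by (simp add: field_simps)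
qed

lemma onorm_on_le:
  assumes "V \<noteq> {}" and "0 \<le> B" and "\<And>x. x \<in> V \<Longrightarrow> norm (T x) \<le> B * norm x"
  shows "onorm_on V T \<le> B"
  unfolding onorm_on_def
proof (rule cSUP_least[OF assms(1)])
  fix x assume "x \<in> V"
  then show "norm (T x) / norm x \<le> B"
    using assms(2) assms(3)[of x] by (cases "x = 0") (auto simp: divide_simps)
qed

lemma onorm_on_approx:
  assumes "V \<noteq> {}" and "c < onorm_on V T"
  obtains x where "x \<in> V" and "c < norm (T x) / norm x"
  using assms less_cSupD[of "(\<lambda>x. norm (T x) / norm x) ` V" c] by (auto simp: onorm_on_def)

lemma onorm_on_nonneg:
  assumes "\<And>x. x \<in> V \<Longrightarrow> norm (T x) \<le> B * norm x" and "0 \<in> V"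
  shows "0 \<le> onorm_on V T"
  using onorm_on_ge[of V T B 0] assms by simp

context normed_space_over
begin

lemma dual_onD:
  assumes "f \<in> dual_on smul V" and "x \<in> V"
  shows "y \<in> V \<Longrightarrow> f (x + y) = f x + f y" and "f (smul c x) = c * f x"
    and "norm (f x) \<le> onorm_on V f * norm x"
proof -
  show "y \<in> V \<Longrightarrow> f (x + y) = f x + f y" "f (smul c x) = c * f x"
    using assms by (auto simp: dual_on_def)
  obtain B where "\<And>x. x \<in> V \<Longrightarrow> norm (f x) \<le> B * norm x"
    using assms(1) unfolding dual_on_def by blast
  then show "norm (f x) \<le> onorm_on V f * norm x" using assms(2) by (rule norm_le_onorm_on)
qed

lemma dual_on_ge:
  assumes "f \<in> dual_on smul V" and "x \<in> V"
  shows "norm (f x) / norm x \<le> onorm_on V f"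
proof -
  obtain B where "\<And>x. x \<in> V \<Longrightarrow> norm (f x) \<le> B * norm x"
    using assms(1) unfolding dual_on_def by blast
  then show ?thesis using assms(2) by (rule onorm_on_ge)
qed

lemma dual_on_onorm_nonneg:
  assumes "f \<in> dual_on smul V" and "subspace V"
  shows "0 \<le> onorm_on V f"
  using dual_on_ge[OF assms(1) subspace_0[OF assms(2)]] by simp

lemma onorm_on_scale:
  assumes f: "f \<in> dual_on smul V" and V: "subspace V"
  shows "onorm_on V (\<lambda>z. c * f z) = norm c * onorm_on V f"
proof (rule antisym)
  have ne: "V \<noteq> {}" using subspace_0[OF V] by auto
  have bd: "norm (c * f z) \<le> (norm c * onorm_on V f) * norm z" if "z \<in> V" for z
    using dual_onD(3)[OF f that] by (simp add: norm_mult mult.assoc mult_left_mono)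
  show "onorm_on V (\<lambda>z. c * f z) \<le> norm c * onorm_on V f"
    using ne dual_on_onorm_nonneg[OF f V] bd by (intro onorm_on_le) auto
  show "norm c * onorm_on V f \<le> onorm_on V (\<lambda>z. c * f z)"
  proof (cases "c = 0")
    case True
    then show ?thesis using onorm_on_nonneg[OF bd subspace_0[OF V]] by simp
  next
    case False
    have "onorm_on V f \<le> onorm_on V (\<lambda>z. c * f z) / norm c"
    proof (rule onorm_on_le[OF ne])
      show "0 \<le> onorm_on V (\<lambda>z. c * f z) / norm c"
        using onorm_on_nonneg[OF bd subspace_0[OF V]] by simp
      fix z assume z: "z \<in> V"
      show "norm (f z) \<le> onorm_on V (\<lambda>z. c * f z) / norm c * norm z"
        using norm_le_onorm_on[of V "\<lambda>z. c * f z", OF bd z] False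
        by (simp add: norm_mult field_simps)
    qed
    then show ?thesis using False by (simp add: field_simps)
  qed
qed

lemma onorm_on_rank_one:
  assumes f: "f \<in> dual_on smul V" and V: "subspace V"
  shows "onorm_on V (\<lambda>z. smul (f z) x) = onorm_on V f * norm x"
proof -
  have "onorm_on V (\<lambda>z. smul (f z) x) = onorm_on V (\<lambda>z. of_real (norm x) * f z)"
    by (simp add: onorm_on_def norm_scale norm_mult mult.commute[of "norm x"])
  also have "\<dots> = norm x * onorm_on V f" by (simp add: onorm_on_scale[OF f V])
  finally show ?thesis by (simp only: mult.commute)
qed

lemma norm_id_plus_rank_one_le:
  assumes f: "f \<in> dual_on smul V" and z: "z \<in> V"
  shows "norm (z + smul (f z) x) \<le> (1 + onorm_on V f * norm x) * norm z"
proof -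
  have "norm (z + smul (f z) x) \<le> norm z + norm (f z) * norm x"
    by (metis norm_scale norm_triangle_ineq)
  also have "\<dots> \<le> norm z + (onorm_on V f * norm z) * norm x"
    using dual_onD(3)[OF f z] by (intro add_left_mono mult_right_mono) auto
  finally show ?thesis by (simp add: algebra_simps)
qed

lemma dual_on_zero: "(\<lambda>x. 0) \<in> dual_on smul V"
  by (auto simp: dual_on_def intro!: exI[of _ 0])

lemma dual_on_add:
  assumes f: "f \<in> dual_on smul V" and g: "g \<in> dual_on smul V"
  shows "(\<lambda>x. f x + g x) \<in> dual_on smul V"
proof -
  have "norm (f x + g x) \<le> (onorm_on V f + onorm_on V g) * norm x" if "x \<in> V" for x
    using norm_triangle_ineq[of "f x" "g x"] dual_onD(3)[OF f that] dual_onD(3)[OF g that]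
    by (simp add: algebra_simps)
  then have "\<exists>B. \<forall>x\<in>V. norm (f x + g x) \<le> B * norm x" by blast
  with f g show ?thesis by (simp add: dual_on_def algebra_simps)
qed

lemma dual_on_scale:
  assumes f: "f \<in> dual_on smul V"
  shows "(\<lambda>x. c * f x) \<in> dual_on smul V"
proof -
  have "norm (c * f x) \<le> (norm c * onorm_on V f) * norm x" if "x \<in> V" for x
    using dual_onD(3)[OF f that] by (simp add: norm_mult mult.assoc mult_left_mono)
  then have "\<exists>B. \<forall>x\<in>V. norm (c * f x) \<le> B * norm x" by blast
  with f show ?thesis by (simp add: dual_on_def algebra_simps)
qed

text \<open>
  Both sides are Lipschitz continuous in the argument, with constants \<open>B = \<parallel>f\<parallel>\<close> and \<open>C\<close>.
\<close>

lemma onorm_on_le_dense: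
  assumes f: "f \<in> dual_on smul V" and V: "subspace V" and C: "0 \<le> C"
    and d: "range d \<subseteq> V" and dense: "\<And>x r. x \<in> V \<Longrightarrow> 0 < r \<Longrightarrow> \<exists>i. dist x (d i) < r"
    and le: "\<And>i. norm (f (d i)) \<le> C * norm (d i)"
  shows "onorm_on V f \<le> C"
proof (rule onorm_on_le)
  show "V \<noteq> {}" using subspace_0[OF V] by auto
  fix x assume x: "x \<in> V"
  define B where "B = onorm_on V f"
  have B: "0 \<le> B" using dual_on_onorm_nonneg[OF f V] by (simp add: B_def)
  show "norm (f x) \<le> C * norm x"
  proof (rule field_le_epsilon)
    fix \<eta> :: real assume "0 < \<eta>"
    then have "0 < \<eta> / (B + C + 1)" using B C by simp
    then obtain i where i: "dist x (d i) < \<eta> / (B + C + 1)" using dense[OF x] by blast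
    have di: "d i \<in> V" using d by auto
    have "f (d i + (x - d i)) = f (d i) + f (x - d i)"
      by (rule dual_onD(1)[OF f di subspace_diff[OF V x di]])
    then have "norm (f x) \<le> norm (f (d i)) + norm (f (x - d i))" by (simp add: norm_triangle_ineq)
    also have "\<dots> \<le> C * norm (d i) + B * dist x (d i)"
      using le[of i] dual_onD(3)[OF f subspace_diff[OF V x di]] by (simp add: B_def dist_norm)
    also have "C * norm (d i) \<le> C * (norm x + dist x (d i))"
      using norm_triangle_sub[of "d i" x] C
      by (intro mult_left_mono) (auto simp: dist_norm norm_minus_commute)
    finally have "norm (f x) \<le> C * norm x + (B + C) * dist x (d i)" by (simp add: algebra_simps)
    moreover have "(B + C + 1) * dist x (d i) \<le> \<eta>" using i B C by (simp add: field_simps)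
    moreover have "(B + C) * dist x (d i) \<le> (B + C + 1) * dist x (d i)"
      by (intro mult_right_mono) auto
    ultimately show "norm (f x) \<le> C * norm x + \<eta>" by linarith
  qed
qed (rule C)

lemma seminorm_infdist:
  assumes T: "subspace T"
  shows "seminorm (\<lambda>x. infdist x T)"
proof -
  have ne: "T \<noteq> {}" using subspace_0[OF T] by auto
  have greatest: "c \<le> infdist x T" if "\<And>a. a \<in> T \<Longrightarrow> c \<le> dist x a" for c x
    using ne that by (auto simp: infdist_notempty intro!: cINF_greatest)
  have le: "infdist (smul c x) T \<le> norm c * infdist x T" if "c \<noteq> 0" for c x
  proof -
    have "infdist (smul c x) T / norm c \<le> dist x a" if a: "a \<in> T" for a
    proof -
      have "infdist (smul c x) T \<le> dist (smul c x) (smul c a)"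
        by (intro infdist_le subspace_scale[OF T a])
      also have "\<dots> = norm c * dist x a"
        by (simp add: dist_norm norm_scale flip: scale_right_diff_distrib)
      finally show ?thesis using \<open>c \<noteq> 0\<close> by (simp add: field_simps)
    qed
    then have "infdist (smul c x) T / norm c \<le> infdist x T" by (rule greatest)
    then show ?thesis using \<open>c \<noteq> 0\<close> by (simp add: field_simps)
  qed
  have "infdist (smul c x) T = norm c * infdist x T" for c x
  proof (cases "c = 0")
    case True
    then show ?thesis using subspace_0[OF T] by simp
  next
    case False
    then have "infdist x T \<le> infdist (smul c x) T / norm c"
      using le[of "1 / c" "smul c x"] by (simp add: norm_divide)
    then show ?thesis using le[of c x] False by (simp add: field_simps)
  qed
  moreover have "infdist (x + y) T \<le> infdist x T + infdist y T" for x y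
  proof -
    have *: "infdist (x + y) T \<le> dist x a + dist y b" if "a \<in> T" "b \<in> T" for a b
    proof -
      have "infdist (x + y) T \<le> dist (x + y) (a + b)"
        by (intro infdist_le subspace_add[OF T that])
      also have "\<dots> \<le> dist x a + dist y b" by (rule dist_triangle_add)
      finally show ?thesis .
    qed
    have "infdist (x + y) T - dist y b \<le> infdist x T" if "b \<in> T" for b
      by (rule greatest) (use *[OF _ that] in \<open>smt (verit)\<close>)
    then have "infdist (x + y) T - infdist x T \<le> infdist y T"
      by (intro greatest) (smt (verit))
    then show ?thesis by simp
  qed
  ultimately show ?thesis by (simp add: seminorm_def)
qed

end

context hahn_banach_space
begin

text \<open>
  The Hahn--Banach theorem for the quotient seminorm: a functional dominated by the distance to \<open>T\<close>
  vanishes on \<open>T\<close>.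
\<close>

lemma annihilating_functional:
  assumes T: "subspace T" and V: "subspace V"
  obtains f where "f \<in> dual_on smul V" and "\<And>z. z \<in> V \<Longrightarrow> norm (f z) \<le> norm z"
    and "\<And>t. t \<in> T \<Longrightarrow> f t = 0" and "x \<in> V \<Longrightarrow> norm (f x) = infdist x T"
proof -
  obtain f where f: "\<And>x y. f (x + y) = f x + f y" "\<And>c x. f (smul c x) = c * f x"
      "\<And>z. norm (f z) \<le> infdist z T" "norm (f x) = infdist x T"
    using hahn_banach[OF seminorm_infdist[OF T], of x] by blast
  define g where "g z = (if z \<in> V then f z else 0)" for z
  have le: "norm (f z) \<le> norm z" for z
    using f(3)[of z] infdist_le[OF subspace_0[OF T], of z] by simp
  show thesis
  proof (rule that)
    show "g \<in> dual_on smul V"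
      using le by (auto simp: dual_on_def g_def f(1,2) subspace_add[OF V] subspace_scale[OF V] intro!: exI[of _ 1])
    show "norm (g z) \<le> norm z" for z using le by (simp add: g_def)
    show "g t = 0" if "t \<in> T" for t using f(3)[of t] that by (simp add: g_def)
    show "norm (g x) = infdist x T" if "x \<in> V" using f(4) that by (simp add: g_def)
  qed
qed

end

section \<open>From the Daugavet property to thickness\<close>

context normed_space_over
begin

text \<open>
  The case \<open>0 \<in> F\<close> shows that \<open>e\<close> has norm almost 1. In the literature this is thickness 2 of the unit
  sphere.
\<close>

definition thick :: "'a set \<Rightarrow> bool" where
  "thick V \<longleftrightarrow> (\<forall>F \<epsilon>. finite F \<and> F \<subseteq> V \<and> 0 < \<epsilon> \<longrightarrow>
     (\<exists>e\<in>V. norm e \<le> 1 \<and> (\<forall>x\<in>F. norm x + 1 - \<epsilon> \<le> norm (x + e))))"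

lemma norming_functional:
  assumes Y: "dual_subspace smul V Y" and norming: "norming_on V Y"
    and x: "x \<in> V" "x \<noteq> 0" and \<epsilon>: "0 < \<epsilon>"
  obtains f where "f \<in> Y" and "onorm_on V f = 1" and "norm x - \<epsilon> < norm (f x)"
proof -
  have "ennreal (norm x - \<epsilon>) < ennreal (norm x)"
    using x \<epsilon> by (intro ennreal_lessI) auto
  also have "\<dots> = (SUP f\<in>{f\<in>Y. onorm_on V f = 1}. ennreal (norm (f x)))"
    using norming x(1) by (simp add: norming_on_def)
  finally obtain f where f: "f \<in> Y" "onorm_on V f = 1" "ennreal (norm x - \<epsilon>) < ennreal (norm (f x))"
    by (auto simp: less_SUP_iff)
  from f(3) have "norm x - \<epsilon> < norm (f x)"
    by (meson ennreal_leI linorder_not_le)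
  with f(1,2) show thesis by (rule that)
qed

lemma rotate_argument:
  assumes f: "f \<in> dual_on smul V" and V: "subspace V" and z: "z \<in> V"
  obtains \<theta> where "norm \<theta> = 1" and "smul \<theta> z \<in> V" and "f (smul \<theta> z) = of_real (norm (f z))"
proof -
  obtain \<theta> where "norm \<theta> = 1" "\<theta> * f z = of_real (norm (f z))" by (rule unimodular_rotation)
  then show thesis using that dual_onD(2)[OF f z] subspace_scale[OF V z] by auto
qed

end

context hahn_banach_space
begin

lemma inner_one_le_norm: "(1::'k) \<bullet> c \<le> norm c"
  using norm_cauchy_schwarz[of "1::'k" c] by simp

lemma inner_one_of_real: "(1::'k) \<bullet> of_real r = r"
  by (simp add: of_real_def inner_same_Basis dot_square_norm)

lemma norming_functional_inner:
  assumes Y: "dual_subspace smul V Y" and V: "subspace V" and norming: "norming_on V Y"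
    and x: "x \<in> V" "x \<noteq> 0" and \<epsilon>: "0 < \<epsilon>"
  obtains f where "f \<in> Y" and "onorm_on V f = 1" and "norm x - \<epsilon> < 1 \<bullet> f x"
proof -
  obtain f where f: "f \<in> Y" "onorm_on V f = 1" "norm x - \<epsilon> < norm (f x)"
    by (rule norming_functional[OF Y norming x \<epsilon>])
  obtain \<theta> where \<theta>: "norm \<theta> = 1" "\<theta> * f x = of_real (norm (f x))" by (rule unimodular_rotation)
  have "f \<in> dual_on smul V" using f(1) Y by (auto simp: dual_subspace_def)
  then have "onorm_on V (\<lambda>z. \<theta> * f z) = 1" by (simp add: onorm_on_scale V \<theta>(1) f(2))
  moreover have "(\<lambda>z. \<theta> * f z) \<in> Y" using f(1) Y by (auto simp: dual_subspace_def)
  ultimately show thesis using f(3) by (intro that) (auto simp: \<theta>(2) inner_one_of_real)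
qed

text \<open>
  The points \<open>w\<close> of the slice of the unit ball that \<open>u\<close> and \<open>\<delta>\<close> cut off are the candidates for \<open>e\<close> in the
  definition of thickness; the predicate says that all of them serve the vector \<open>x\<close>.
\<close>

definition slice_reaches :: "'a set \<Rightarrow> ('a \<Rightarrow> 'k) \<Rightarrow> real \<Rightarrow> real \<Rightarrow> 'a \<Rightarrow> bool" where
  "slice_reaches V u \<delta> \<epsilon> x \<longleftrightarrow>
     (\<forall>w\<in>V. norm w \<le> 1 \<and> 1 - \<delta> < 1 \<bullet> u w \<longrightarrow> norm x + 1 - \<epsilon> \<le> norm (x + w))"

text \<open>
  If \<open>\<parallel>w + u (w) x\<parallel>\<close> is almost \<open>1 + \<parallel>x\<parallel>\<close> with \<open>w\<close> of norm 1, rotated such that \<open>s = u w \<ge> 0\<close>, and \<open>z \<in> Y\<close>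
  almost attains this norm, then \<open>z w\<close>, \<open>s\<close> and \<open>z x / \<parallel>x\<parallel>\<close> are all almost 1, since none of them exceeds 1.
  So \<open>z + u\<close> has norm almost 2. Where it is almost 2, both \<open>z\<close> and \<open>u\<close> are almost 1.
\<close>

lemma daugavet_subslice:
  assumes V: "subspace V" and Y: "dual_subspace smul V Y"
    and norming: "norming_on V Y" and daugavet: "daugavet_wrt smul V Y"
    and u: "u \<in> Y" "onorm_on V u = 1" and x: "x \<in> V" and "0 < \<delta>" "0 < \<epsilon>"
  obtains v \<gamma> where "v \<in> Y" and "onorm_on V v = 1" and "0 < \<gamma>"
    and "slice_reaches V v \<gamma> \<epsilon> x"
    and "\<And>w. w \<in> V \<Longrightarrow> norm w \<le> 1 \<Longrightarrow> 1 - \<gamma> < 1 \<bullet> v w \<Longrightarrow> 1 - \<delta> < 1 \<bullet> u w"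
proof (cases "x = 0")
  case True
  have "1 - \<epsilon> \<le> norm w" if w: "w \<in> V" "1 - min \<delta> \<epsilon> < 1 \<bullet> u w" for w
  proof -
    have "u \<in> dual_on smul V" using u(1) Y by (auto simp: dual_subspace_def)
    from dual_onD(3)[OF this w(1)] have "norm (u w) \<le> norm w" by (simp add: u(2))
    with inner_one_le_norm[of "u w"] w(2) show ?thesis by simp
  qed
  then show thesis
    using u True \<open>0 < \<delta>\<close> \<open>0 < \<epsilon>\<close> by (intro that[of u "min \<delta> \<epsilon>"]) (auto simp: slice_reaches_def)
next
  case False
  have dual: "f \<in> dual_on smul V" if "f \<in> Y" for f using that Y by (auto simp: dual_subspace_def)
  \<comment> \<open>The errors below add up to at most \<open>4 \<kappa>\<close> for the slices and \<open>5 \<kappa>\<close> for the norm.\<close>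
  define \<kappa> where "\<kappa> = Min {\<delta>, \<epsilon>, 1} / 8"
  have \<kappa>: "0 < \<kappa>" "8 * \<kappa> \<le> \<delta>" "8 * \<kappa> \<le> \<epsilon>" "8 * \<kappa> \<le> 1"
    using \<open>0 < \<delta>\<close> \<open>0 < \<epsilon>\<close> by (auto simp: \<kappa>_def)
  \<comment> \<open>Dividing the error \<open>\<eta>\<close> by \<open>\<parallel>x\<parallel>\<close> must still leave at most \<open>\<kappa>\<close>, whatever the size of \<open>x\<close>.\<close>
  define \<eta> where "\<eta> = \<kappa> * min 1 (norm x)"
  have \<eta>: "0 < \<eta>" "\<eta> \<le> \<kappa>" "\<eta> \<le> \<kappa> * norm x" "\<eta> \<le> norm x"
  proof -
    show "0 < \<eta>" using \<kappa> False by (simp add: \<eta>_def)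
    show "\<eta> \<le> \<kappa>" "\<eta> \<le> \<kappa> * norm x" using \<kappa> by (auto simp: \<eta>_def mult_left_le)
    moreover have "\<kappa> * norm x \<le> norm x" using \<kappa> by (simp add: mult_left_le_one_le)
    ultimately show "\<eta> \<le> norm x" by simp
  qed
  have "onorm_on V (\<lambda>z. z + smul (u z) x) = 1 + norm x"
    using daugavet x u by (simp add: daugavet_wrt_def onorm_on_rank_one dual V)
  then obtain y where y: "y \<in> V" "1 + norm x - \<eta> < norm (y + smul (u y) x) / norm y"
    using onorm_on_approx[of V "1 + norm x - \<eta>" "\<lambda>z. z + smul (u z) x"] x \<eta>(1) by auto
  then have "y \<noteq> 0" using \<eta>(4) by auto
  define y' where "y' = smul (of_real (1 / norm y)) y"
  have y': "y' \<in> V" "norm y' = 1"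
    using \<open>y \<noteq> 0\<close> by (auto simp: y'_def subspace_scale[OF V y(1)] norm_scale norm_divide)
  have "y' + smul (u y') x = smul (of_real (1 / norm y)) (y + smul (u y) x)"
    unfolding y'_def dual_onD(2)[OF dual[OF u(1)] y(1)] by (simp add: scale_right_distrib)
  then have y'_ge: "1 + norm x - \<eta> < norm (y' + smul (u y') x)"
    using y(2) \<open>y \<noteq> 0\<close> by (simp add: norm_scale norm_divide)
  obtain \<theta> where \<theta>: "norm \<theta> = 1" "smul \<theta> y' \<in> V" "u (smul \<theta> y') = of_real (norm (u y'))"
    by (rule rotate_argument[OF dual[OF u(1)] V y'(1)])
  define w where "w = smul \<theta> y'"
  define s where "s = norm (u y')"
  have w: "w \<in> V" "norm w = 1" "u w = of_real s"
    using \<theta> y' by (auto simp: w_def s_def norm_scale)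
  have "w + smul (u w) x = smul \<theta> (y' + smul (u y') x)"
    unfolding w_def dual_onD(2)[OF dual[OF u(1)] y'(1)] by (simp add: scale_right_distrib)
  then have big: "1 + norm x - \<eta> < norm (w + s *\<^sub>R x)"
    using y'_ge \<theta>(1) w(3) by (simp add: norm_scale scale_of_real)
  have s: "0 \<le> s" "s \<le> 1"
    using dual_onD(3)[OF dual[OF u(1)] y'(1)] y'(2) u(2) by (auto simp: s_def)
  have wx: "w + s *\<^sub>R x \<in> V"
    using subspace_add[OF V w(1) subspace_scale[OF V x, of "of_real s"]] by (simp add: scale_of_real)
  have "w + s *\<^sub>R x \<noteq> 0" using big \<eta>(4) by auto
  moreover have "0 < norm (w + s *\<^sub>R x) - (1 + norm x - \<eta>)" using big by simp
  ultimately obtain z where z: "z \<in> Y" "onorm_on V z = 1"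
    and "norm (w + s *\<^sub>R x) - (norm (w + s *\<^sub>R x) - (1 + norm x - \<eta>)) < 1 \<bullet> z (w + s *\<^sub>R x)"
    by (rule norming_functional_inner[OF Y V norming wx])
  then have z_gt: "1 + norm x - \<eta> < 1 \<bullet> z (w + s *\<^sub>R x)" by simp
  have le1: "1 \<bullet> f a \<le> norm a" if "f \<in> Y" "onorm_on V f = 1" "a \<in> V" for f a
    using dual_onD(3)[OF dual[OF that(1)] that(3)] that(2) inner_one_le_norm[of "f a"] by simp
  define t where "t = 1 \<bullet> z x"
  have "z (w + s *\<^sub>R x) = z w + of_real s * z x"
    using dual_onD(1)[OF dual[OF z(1)] w(1) subspace_scale[OF V x, of "of_real s"]]
      dual_onD(2)[OF dual[OF z(1)] x, of "of_real s"] by (simp add: scale_of_real)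
  then have zw: "1 \<bullet> z (w + s *\<^sub>R x) = 1 \<bullet> z w + s * t"
    by (simp add: inner_add_right t_def scaleR_conv_of_real[symmetric])
  have t: "t \<le> norm x" using le1[OF z x] by (simp add: t_def)
  have st: "norm x - \<eta> < s * t"
    using z_gt zw le1[OF z w(1)] w(2) by simp
  then have "0 < s * t" using \<eta>(4) by simp
  then have "0 < t" using s by (simp add: zero_less_mult_iff)
  then have "s * t \<le> t" using s by (simp add: mult_left_le_one_le)
  then have t_gt: "norm x - \<eta> < t" using st by simp
  have "s * t \<le> s * norm x" using s t by (simp add: mult_left_mono)
  then have "(1 - \<kappa>) * norm x < s * norm x" using st \<eta>(3) by (simp add: algebra_simps)
  then have s_gt: "1 - \<kappa> < s" using False by simp
  have "s * t \<le> norm x" using \<open>s * t \<le> t\<close> t by simp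
  then have zw_gt: "1 - \<eta> < 1 \<bullet> z w" using z_gt zw by simp
  define g where "g = (\<lambda>a. z a + u a)"
  define m where "m = onorm_on V g"
  have g: "g \<in> Y" using z(1) u(1) Y by (auto simp: g_def dual_subspace_def)
  have "2 - 2 * \<kappa> < 1 \<bullet> g w"
    using zw_gt s_gt \<eta>(2) by (simp add: g_def inner_add_right w(3) inner_one_of_real)
  also have "\<dots> \<le> m"
    using dual_onD(3)[OF dual[OF g] w(1)] inner_one_le_norm[of "g w"] w(2) by (simp add: m_def)
  finally have m_gt: "2 - 2 * \<kappa> < m" .
  then have "0 < m" using \<kappa> by simp
  have m_le: "m \<le> 2" unfolding m_def
  proof (rule onorm_on_le)
    fix a assume a: "a \<in> V"
    have "norm (g a) \<le> norm (z a) + norm (u a)" by (simp add: g_def norm_triangle_ineq)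
    also have "\<dots> \<le> 2 * norm a"
      using dual_onD(3)[OF dual[OF z(1)] a] dual_onD(3)[OF dual[OF u(1)] a] z(2) u(2) by simp
    finally show "norm (g a) \<le> 2 * norm a" .
  qed (use x in auto)
  define v where "v = (\<lambda>a. of_real (1 / m) * g a)"
  have "v \<in> Y" using g Y unfolding v_def dual_subspace_def by blast
  moreover have "onorm_on V v = 1"
    unfolding v_def using onorm_on_scale[OF dual[OF g] V, of "of_real (1 / m)"] \<open>0 < m\<close>
    by (simp add: m_def norm_divide)
  moreover have key: "1 - 4 * \<kappa> < 1 \<bullet> z a \<and> 1 - 4 * \<kappa> < 1 \<bullet> u a"
    if a: "a \<in> V" "norm a \<le> 1" "1 - \<kappa> < 1 \<bullet> v a" for a
  proof -
    have "1 \<bullet> v a = (1 \<bullet> g a) / m"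
      unfolding v_def scaleR_conv_of_real[symmetric] by simp
    then have "(1 - \<kappa>) * m < 1 \<bullet> g a" using a(3) \<open>0 < m\<close> by (simp add: pos_less_divide_eq)
    moreover have "m - 2 * \<kappa> \<le> (1 - \<kappa>) * m"
      using m_le \<kappa>(1) by (simp add: algebra_simps)
    ultimately have "2 - 4 * \<kappa> < 1 \<bullet> z a + 1 \<bullet> u a"
      using m_gt by (simp add: g_def inner_add_right)
    with le1[OF z a(1)] le1[OF u a(1)] a(2) show ?thesis by simp
  qed
  moreover have "slice_reaches V v \<kappa> \<epsilon> x"
    unfolding slice_reaches_def
  proof (intro ballI impI, elim conjE)
    fix a assume a: "a \<in> V" "norm a \<le> 1" "1 - \<kappa> < 1 \<bullet> v a"
    have "norm x + 1 - \<epsilon> \<le> t + 1 \<bullet> z a"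
      using key[OF a] t_gt \<eta>(2) \<kappa> by simp
    also have "\<dots> = 1 \<bullet> z (x + a)"
      by (simp add: dual_onD(1)[OF dual[OF z(1)] x a(1)] inner_add_right t_def)
    also have "\<dots> \<le> norm (x + a)" by (rule le1[OF z subspace_add[OF V x a(1)]])
    finally show "norm x + 1 - \<epsilon> \<le> norm (x + a)" .
  qed
  moreover have "1 - \<delta> < 1 \<bullet> u a"
    if "a \<in> V" "norm a \<le> 1" "1 - \<kappa> < 1 \<bullet> v a" for a
    using key[OF that] \<kappa> by linarith
  ultimately show thesis using \<kappa>(1) that by blast
qed

lemma daugavet_slice:
  assumes V: "subspace V" and Y: "dual_subspace smul V Y"
    and norming: "norming_on V Y" and daugavet: "daugavet_wrt smul V Y"
    and "finite F" "F \<subseteq> V" "0 < \<epsilon>"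
  obtains u \<delta> where "u \<in> Y" and "onorm_on V u = 1" and "0 < \<delta>"
    and "\<And>x. x \<in> F \<Longrightarrow> slice_reaches V u \<delta> \<epsilon> x"
proof -
  \<comment> \<open>For empty \<open>F\<close> the Daugavet equation of the zero operator says that \<open>V\<close> is not the zero space,
    so a norming subspace contains a functional of norm 1.\<close>
  have "\<exists>u\<in>Y. onorm_on V u = 1 \<and> (\<exists>\<delta>>0. \<forall>x\<in>F. slice_reaches V u \<delta> \<epsilon> x)"
    using \<open>finite F\<close> \<open>F \<subseteq> V\<close>
  proof (induction F rule: finite_induct)
    case empty
    have zero: "(\<lambda>x. 0) \<in> Y" using Y by (simp add: dual_subspace_def)
    have "onorm_on V (\<lambda>z. z) = 1 + onorm_on V (\<lambda>z. 0::'a)"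
      using daugavet subspace_0[OF V] zero by (force simp: daugavet_wrt_def)
    then have "0 < onorm_on V (\<lambda>z. z)"
      using onorm_on_nonneg[of V "\<lambda>z. 0::'a" 0] subspace_0[OF V] by simp
    then obtain x where "x \<in> V" "x \<noteq> 0"
      using onorm_on_approx[of V 0 "\<lambda>z. z"] subspace_0[OF V] by force
    then obtain u where "u \<in> Y" "onorm_on V u = 1"
      using norming_functional[OF Y norming, of x 1] by auto
    then show ?case by (auto intro: exI[of _ 1])
  next
    case (insert x F)
    then have "\<exists>u\<in>Y. onorm_on V u = 1 \<and> (\<exists>\<delta>>0. \<forall>x\<in>F. slice_reaches V u \<delta> \<epsilon> x)" by simp
    then obtain u \<delta> where u: "u \<in> Y" "onorm_on V u = 1" "0 < \<delta>"
      "\<forall>y\<in>F. slice_reaches V u \<delta> \<epsilon> y" by blast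
    from insert.prems have "x \<in> V" by simp
    from daugavet_subslice[OF V Y norming daugavet u(1,2) this u(3) \<open>0 < \<epsilon>\<close>]
    obtain v \<gamma> where v: "v \<in> Y" "onorm_on V v = 1" "0 < \<gamma>" "slice_reaches V v \<gamma> \<epsilon> x"
      and sub: "\<And>w. w \<in> V \<Longrightarrow> norm w \<le> 1 \<Longrightarrow> 1 - \<gamma> < 1 \<bullet> v w \<Longrightarrow> 1 - \<delta> < 1 \<bullet> u w"
      by blast
    have "slice_reaches V v \<gamma> \<epsilon> y" if "y \<in> F" for y
      using u(4) that sub by (auto simp: slice_reaches_def)
    with v show ?case by blast
  qed
  then show thesis using that by blast
qed

theorem almost_daugavet_imp_thick:
  assumes V: "subspace V" and ad: "almost_daugavet smul V"
  shows "thick V"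
  unfolding thick_def
proof (intro allI impI, elim conjE)
  fix F \<epsilon> assume F: "finite F" "F \<subseteq> V" "0 < (\<epsilon>::real)"
  obtain Y where Y: "dual_subspace smul V Y" "norming_on V Y" "daugavet_wrt smul V Y"
    using ad by (auto simp: almost_daugavet_def)
  obtain u \<delta> where u: "u \<in> Y" "onorm_on V u = 1" "0 < \<delta>"
    "\<And>x. x \<in> F \<Longrightarrow> slice_reaches V u \<delta> \<epsilon> x" using daugavet_slice[OF V Y F] by blast
  have dual: "u \<in> dual_on smul V" using u(1) Y(1) by (auto simp: dual_subspace_def)
  have "max 0 (1 - \<delta>) < onorm_on V u" using u(2,3) by simp
  then obtain y where y: "y \<in> V" "max 0 (1 - \<delta>) < norm (u y) / norm y"
    using onorm_on_approx[of V] subspace_0[OF V] by blast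
  then have "y \<noteq> 0" by auto
  obtain \<theta> where \<theta>: "norm \<theta> = 1" "smul \<theta> y \<in> V" "u (smul \<theta> y) = of_real (norm (u y))"
    by (rule rotate_argument[OF dual V y(1)])
  define w where "w = smul (of_real (1 / norm y)) (smul \<theta> y)"
  have w: "w \<in> V" "norm w = 1"
    using \<theta> \<open>y \<noteq> 0\<close> by (auto simp: w_def norm_scale norm_divide subspace_scale[OF V] norm_mult y)
  have "u w = of_real (1 / norm y) * of_real (norm (u y))"
    unfolding w_def dual_onD(2)[OF dual \<theta>(2)] \<theta>(3) ..
  then have "u w = of_real (norm (u y) / norm y)" by simp
  then have "1 \<bullet> u w = norm (u y) / norm y" by (simp only: inner_one_of_real)
  with y(2) have "1 - \<delta> < 1 \<bullet> u w" by simp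
  then show "\<exists>e\<in>V. norm e \<le> 1 \<and> (\<forall>x\<in>F. norm x + 1 - \<epsilon> \<le> norm (x + e))"
    using w u(4) by (auto simp: slice_reaches_def intro!: bexI[of _ w])
qed

end

section \<open>Thickness and L-summands\<close>

context normed_space_over
begin

text \<open>
  A vector that is almost l1-orthogonal to \<open>x\<close> stays so after normalization: for \<open>t = \<parallel>e\<parallel> \<le> 1\<close> the triangle
  inequality gives \<open>\<parallel>t x + e\<parallel> \<ge> \<parallel>x + e\<parallel> - (1 - t) \<parallel>x\<parallel>\<close>, and division by \<open>t\<close> multiplies the error by at
  most 3.
\<close>

lemma thick_if_long_vectors:
  assumes V: "subspace V"
    and long: "\<And>F \<epsilon>. finite F \<Longrightarrow> F \<subseteq> V \<Longrightarrow> 0 < \<epsilon> \<Longrightarrow>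
      \<exists>e\<in>V. 1 / 3 \<le> norm e \<and> norm e \<le> 1 \<and> (\<forall>x\<in>F. norm x + norm e - \<epsilon> \<le> norm (x + e))"
  shows "thick V"
  unfolding thick_def
proof (intro allI impI, elim conjE)
  fix F \<epsilon> assume F: "finite F" "F \<subseteq> V" "0 < (\<epsilon>::real)"
  then obtain e where e: "e \<in> V" "1 / 3 \<le> norm e" "norm e \<le> 1"
    "\<And>x. x \<in> F \<Longrightarrow> norm x + norm e - \<epsilon> / 3 \<le> norm (x + e)"
    using long[of F "\<epsilon> / 3"] by auto
  define t where "t = norm e"
  have t: "1 / 3 \<le> t" "t \<le> 1" using e by (auto simp: t_def)
  define e' where "e' = (1 / t) *\<^sub>R e"
  have "e' = smul (of_real (1 / t)) e" by (simp only: e'_def scale_of_real)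
  then have "e' \<in> V" using subspace_scale[OF V e(1)] by simp
  moreover have "norm e' \<le> 1" using t by (simp add: e'_def t_def)
  moreover have "norm x + 1 - \<epsilon> \<le> norm (x + e')" if "x \<in> F" for x
  proof -
    have "t *\<^sub>R (x + e') = (x + e) - (1 - t) *\<^sub>R x"
      using t by (simp add: e'_def scaleR_add_right scaleR_diff_left)
    moreover have "norm ((1 - t) *\<^sub>R x) = (1 - t) * norm x" "norm (t *\<^sub>R (x + e')) = t * norm (x + e')"
      using t by simp_all
    ultimately have "norm (x + e) - (1 - t) * norm x \<le> t * norm (x + e')"
      using norm_triangle_ineq2[of "x + e" "(1 - t) *\<^sub>R x"] by (simp only:)
    then have "t * (norm x + 1) - \<epsilon> / 3 \<le> t * norm (x + e')"
      using e(4)[OF that] by (simp add: t_def algebra_simps)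
    moreover have "\<epsilon> / 3 \<le> t * \<epsilon>" using t F(3) by (simp add: mult_right_mono)
    ultimately have "t * (norm x + 1 - \<epsilon>) \<le> t * norm (x + e')" by (simp add: algebra_simps)
    then show ?thesis using t by (simp add: mult_le_cancel_left)
  qed
  ultimately show "\<exists>e\<in>V. norm e \<le> 1 \<and> (\<forall>x\<in>F. norm x + 1 - \<epsilon> \<le> norm (x + e))" by blast
qed

text \<open>
  The two halves \<open>u\<close>, \<open>v\<close> of \<open>e\<close> have total norm between 2/3 and 1 as soon as the error is at most 1/3; this is
  the origin of the bound 1/3.
\<close>

theorem thick_L_summand:
  assumes L: "L_decomposition smul J J'" and thick: "thick UNIV"
  shows "thick J \<or> thick J'"
proof -
  have J: "subspace J" and J': "subspace J'"
    and norm_add: "\<And>u v. u \<in> J \<Longrightarrow> v \<in> J' \<Longrightarrow> norm (u + v) = norm u + norm v"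
    using L by (simp_all add: L_decomposition_def)
  have decomp: "\<exists>u v. u \<in> J \<and> v \<in> J' \<and> x = u + v" for x
  proof -
    have "\<exists>!p. p \<in> J \<times> J' \<and> x = fst p + snd p" using L by (simp add: L_decomposition_def)
    then obtain p where "p \<in> J \<times> J'" "x = fst p + snd p" by blast
    then show ?thesis by (intro exI[of _ "fst p"] exI[of _ "snd p"]) (simp add: mem_Times_iff)
  qed
  have pair: "\<exists>u\<in>J. \<exists>v\<in>J'. norm u \<le> 1 \<and> norm v \<le> 1 \<and> (1 / 3 \<le> norm u \<or> 1 / 3 \<le> norm v) \<and>
      (\<forall>x\<in>F. norm x + norm u - \<epsilon> \<le> norm (x + u)) \<and> (\<forall>y\<in>G. norm y + norm v - \<epsilon> \<le> norm (y + v))"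
    if FG: "finite F" "F \<subseteq> J" "finite G" "G \<subseteq> J'" "0 < \<epsilon>" for F G and \<epsilon> :: real
  proof -
    \<comment> \<open>Test vectors \<open>x + y\<close> with \<open>y = 0\<close> give the estimate for \<open>u\<close>, those with \<open>x = 0\<close> the one for \<open>v\<close>,
      and \<open>0\<close> shows that \<open>e\<close> is not short.\<close>
    define \<delta> where "\<delta> = min \<epsilon> (1 / 3)"
    define H where "H = (\<lambda>(x, y). x + y) ` (insert 0 F \<times> insert 0 G)"
    have "finite H" "0 < \<delta>" using FG by (auto simp: H_def \<delta>_def)
    then obtain e where e: "norm e \<le> 1" "\<And>z. z \<in> H \<Longrightarrow> norm z + 1 - \<delta> \<le> norm (z + e)"
      using thick[unfolded thick_def, rule_format, of H \<delta>] by auto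
    obtain u v where uv: "u \<in> J" "v \<in> J'" "e = u + v" using decomp by blast
    have norm_e: "norm u + norm v \<le> 1" using e(1) norm_add[OF uv(1,2)] uv(3) by simp
    have *: "norm x + norm y + 1 - \<delta> \<le> norm (x + u) + norm (y + v)"
      if "x \<in> insert 0 F" "y \<in> insert 0 G" for x y
    proof -
      have "x \<in> J" "y \<in> J'" using that FG subspace_0[OF J] subspace_0[OF J'] by auto
      then have "norm (x + y) = norm x + norm y"
        "norm ((x + u) + (y + v)) = norm (x + u) + norm (y + v)"
        using uv(1,2) subspace_add[OF J, of x u] subspace_add[OF J', of y v] by (simp_all add: norm_add)
      moreover have "x + y \<in> H" using that by (auto simp: H_def)
      ultimately show ?thesis using e(2)[of "x + y"] uv(3) by (simp add: algebra_simps)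
    qed
    have "1 / 3 \<le> norm u \<or> 1 / 3 \<le> norm v" using *[of 0 0] by (auto simp: \<delta>_def)
    moreover have "norm x + norm u - \<epsilon> \<le> norm (x + u)" if "x \<in> F" for x
      using *[of x 0] that norm_e by (auto simp: \<delta>_def)
    moreover have "norm y + norm v - \<epsilon> \<le> norm (y + v)" if "y \<in> G" for y
      using *[of 0 y] that norm_e by (auto simp: \<delta>_def)
    moreover have "norm u \<le> 1" "norm v \<le> 1"
      using norm_e norm_ge_zero[of u] norm_ge_zero[of v] by linarith+
    ultimately show ?thesis using uv(1,2) by blast
  qed
  define long where "long V F \<epsilon> e \<longleftrightarrow> e \<in> V \<and> 1 / 3 \<le> norm e \<and> norm e \<le> 1 \<and>
      (\<forall>x\<in>F. norm x + norm e - \<epsilon> \<le> norm (x + e))" for V F \<epsilon> and e :: 'a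
  show ?thesis
  proof (cases "\<forall>F \<epsilon>. finite F \<longrightarrow> F \<subseteq> J \<longrightarrow> 0 < \<epsilon> \<longrightarrow> (\<exists>e. long J F \<epsilon> e)")
    case True
    have "thick J"
    proof (rule thick_if_long_vectors[OF J])
      fix F \<epsilon> assume "finite F" "F \<subseteq> J" "0 < (\<epsilon>::real)"
      with True obtain e where "long J F \<epsilon> e" by blast
      then show "\<exists>e\<in>J. 1 / 3 \<le> norm e \<and> norm e \<le> 1 \<and> (\<forall>x\<in>F. norm x + norm e - \<epsilon> \<le> norm (x + e))"
        by (auto simp: long_def)
    qed
    then show ?thesis ..
  next
    case False
    then obtain F \<epsilon> where F: "finite F" "F \<subseteq> J" "0 < \<epsilon>" and bad: "\<not> (\<exists>e. long J F \<epsilon> e)" by blast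
    have "thick J'"
    proof (rule thick_if_long_vectors[OF J'])
      fix G \<epsilon>' assume G: "finite G" "G \<subseteq> J'" "0 < (\<epsilon>'::real)"
      have "0 < min \<epsilon> \<epsilon>'" using F(3) G(3) by simp
      from pair[OF F(1,2) G(1,2) this] obtain u v where uv: "u \<in> J" "v \<in> J'" "norm u \<le> 1" "norm v \<le> 1"
        and third: "1 / 3 \<le> norm u \<or> 1 / 3 \<le> norm v"
        and u: "\<forall>x\<in>F. norm x + norm u - min \<epsilon> \<epsilon>' \<le> norm (x + u)"
        and v: "\<forall>y\<in>G. norm y + norm v - min \<epsilon> \<epsilon>' \<le> norm (y + v)"
        by blast
      have "\<not> 1 / 3 \<le> norm u"
      proof
        assume "1 / 3 \<le> norm u"
        then have "long J F \<epsilon> u" using uv u by (force simp: long_def)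
        with bad show False by blast
      qed
      with third have "1 / 3 \<le> norm v" by blast
      moreover have "\<forall>y\<in>G. norm y + norm v - \<epsilon>' \<le> norm (y + v)" using v by force
      ultimately show "\<exists>e\<in>J'. 1 / 3 \<le> norm e \<and> norm e \<le> 1 \<and> (\<forall>x\<in>G. norm x + norm e - \<epsilon>' \<le> norm (x + e))"
        using uv(2,4) by blast
    qed
    then show ?thesis ..
  qed
qed

end

section \<open>Sequences that are almost isometrically of type l1\<close>

context hahn_banach_space
begin

text \<open>
  These are the finite-dimensional subspaces. Compactness of balls is the only consequence of finite
  dimension that matters here, and it is easily preserved when a vector is adjoined.
\<close>

definition boundedly_compact :: "'a set \<Rightarrow> bool" where
  "boundedly_compact W \<longleftrightarrow> subspace W \<and> (\<forall>R. compact (W \<inter> cball 0 R))"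

lemma boundedly_compact_closed:
  assumes "boundedly_compact W"
  shows "closed W"
  unfolding closed_sequential_limits
proof (intro allI impI, elim conjE)
  fix x l assume x: "\<forall>n. x n \<in> W" "x \<longlonglongrightarrow> l"
  then obtain R where R: "\<And>n. norm (x n) \<le> R"
    using convergent_imp_bounded[OF x(2)] by (auto simp: bounded_iff)
  have "closed (W \<inter> cball 0 R)"
    using assms by (auto simp: boundedly_compact_def intro: compact_imp_closed)
  then have "l \<in> W \<inter> cball 0 R"
    using x R by (intro closed_sequentially[of _ x l]) auto
  then show "l \<in> W" by simp
qed

text \<open>
  If \<open>a\<close> has distance \<open>\<rho> > 0\<close> from \<open>W\<close>, then \<open>\<parallel>x + c a\<parallel> \<le> R\<close> bounds \<open>c\<close> by \<open>R / \<rho>\<close> and hence \<open>x\<close> as well. So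
  a ball of \<open>W + K a\<close> lies in the sum of two compact sets.
\<close>

lemma boundedly_compact_insert:
  assumes W: "boundedly_compact W"
  obtains W' where "boundedly_compact W'" and "W \<subseteq> W'" and "a \<in> W'"
    and "\<And>V. subspace V \<Longrightarrow> W \<subseteq> V \<Longrightarrow> a \<in> V \<Longrightarrow> W' \<subseteq> V"
proof (cases "a \<in> W")
  case True
  then show thesis using that[OF W] by auto
next
  case False
  have sub: "subspace W" and comp: "\<And>R. compact (W \<inter> cball 0 R)"
    using W by (auto simp: boundedly_compact_def)
  define \<rho> where "\<rho> = infdist a W"
  have "0 < \<rho>"
    unfolding \<rho>_def using boundedly_compact_closed[OF W] subspace_0[OF sub] False
    by (intro infdist_pos_not_in_closed) auto
  define W' where "W' = {x + y |x y. x \<in> W \<and> y \<in> range (\<lambda>c. smul c a)}"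
  have "subspace (range (\<lambda>c. smul c a))"
    using subspace_span[of "{a}"] by (simp add: span_singleton)
  then have sub': "subspace W'" unfolding W'_def by (rule subspace_sums[OF sub])
  have bound: "norm c * \<rho> \<le> norm (x + smul c a)" if x: "x \<in> W" for c x
  proof (cases "c = 0")
    case False
    have "\<rho> \<le> dist a (smul (- (1 / c)) x)"
      unfolding \<rho>_def by (intro infdist_le subspace_scale[OF sub x])
    then have "norm c * \<rho> \<le> norm c * norm (a + smul (1 / c) x)"
      by (intro mult_left_mono) (auto simp: dist_norm)
    also have "\<dots> = norm (smul c (a + smul (1 / c) x))" by (simp add: norm_scale)
    also have "smul c (a + smul (1 / c) x) = x + smul c a"
      using False by (simp add: scale_right_distrib add.commute)
    finally show ?thesis .
  qed simp
  have cont: "continuous_on UNIV (\<lambda>c. smul c a)"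
  proof (rule linear_continuous_on, rule bounded_linear_intro)
    show "smul (r *\<^sub>R c) a = r *\<^sub>R smul c a" for r c
      by (simp add: scaleR_conv_of_real flip: scale_of_real)
    show "norm (smul c a) \<le> norm c * norm a" for c by (simp add: norm_scale)
  qed (rule scale_left_distrib)
  have "compact (W' \<inter> cball 0 R)" for R
  proof -
    define K where "K = {x + y |x y. x \<in> W \<inter> cball 0 (R + R / \<rho> * norm a) \<and> y \<in> (\<lambda>c. smul c a) ` cball 0 (R / \<rho>)}"
    have "compact K"
      unfolding K_def using continuous_on_subset[OF cont]
      by (intro compact_sums comp compact_continuous_image) auto
    moreover have "W' \<inter> cball 0 R = K \<inter> cball 0 R"
    proof (intro equalityI subsetI)
      fix z assume "z \<in> W' \<inter> cball 0 R"
      then obtain x c where z: "z = x + smul c a" "x \<in> W" "norm z \<le> R" by (auto simp: W'_def)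
      have "norm c * \<rho> \<le> R" using bound[OF z(2), of c] z(1,3) by simp
      then have c: "norm c \<le> R / \<rho>" using \<open>0 < \<rho>\<close> by (simp add: field_simps)
      have "norm x \<le> norm z + norm (smul c a)" using norm_triangle_ineq4[of z "smul c a"] z(1) by simp
      also have "\<dots> \<le> R + R / \<rho> * norm a"
        unfolding norm_scale using z(3) c by (intro add_mono mult_right_mono) auto
      finally have "x \<in> W \<inter> cball 0 (R + R / \<rho> * norm a)" using z(2) by simp
      moreover have "smul c a \<in> (\<lambda>c. smul c a) ` cball 0 (R / \<rho>)" using c by (intro imageI) simp
      ultimately have "z \<in> K" unfolding K_def z(1) by blast
      then show "z \<in> K \<inter> cball 0 R" using z(3) by simp
    qed (auto simp: K_def W'_def)
    ultimately show ?thesis by (simp add: compact_Int_closed)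
  qed
  with sub' have "boundedly_compact W'" by (simp add: boundedly_compact_def)
  moreover have "W \<subseteq> W'"
  proof
    fix x assume "x \<in> W"
    moreover have "x = x + smul 0 a" by simp
    ultimately show "x \<in> W'" unfolding W'_def by blast
  qed
  moreover have "a \<in> W'"
  proof -
    have "a = 0 + smul 1 a" by simp
    then show ?thesis using subspace_0[OF sub] unfolding W'_def by blast
  qed
  moreover have "W' \<subseteq> V" if "subspace V" "W \<subseteq> V" "a \<in> V" for V
    using that by (auto simp: W'_def intro!: subspace_add[OF that(1)] subspace_scale[OF that(1)])
  ultimately show thesis by (rule that)
qed

text \<open>
  By homogeneity it suffices to treat \<open>c = 1\<close>. A finite net of a ball of \<open>W\<close> handles the vectors \<open>w\<close> of norm
  at most \<open>2 / \<epsilon>\<close>; for longer ones the multiplicative error exceeds the loss of 2 in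
  \<open>\<parallel>w + e\<parallel> \<ge> \<parallel>w\<parallel> - 1\<close>.
\<close>

lemma thick_uniform:
  assumes thick: "thick V" and W: "boundedly_compact W" "W \<subseteq> V" and \<epsilon>: "0 < \<epsilon>" "\<epsilon> < 1"
  obtains e where "e \<in> V" and "norm e \<le> 1"
    and "\<And>w c. w \<in> W \<Longrightarrow> (1 - \<epsilon>) * (norm w + norm c) \<le> norm (w + smul c e)"
proof -
  define K where "K = W \<inter> cball 0 (2 / \<epsilon>)"
  have "compact K" using W by (simp add: K_def boundedly_compact_def)
  moreover have "\<And>x. x \<in> K \<Longrightarrow> open (ball x (\<epsilon> / 3))" by simp
  moreover have "K \<subseteq> (\<Union>x\<in>K. ball x (\<epsilon> / 3))" using \<epsilon> by auto
  ultimately obtain F where F: "F \<subseteq> K" "finite F" "K \<subseteq> (\<Union>x\<in>F. ball x (\<epsilon> / 3))"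
    by (rule compactE_image)
  have "F \<subseteq> V" using F(1) W(2) by (auto simp: K_def)
  then obtain e where e: "e \<in> V" "norm e \<le> 1" "\<And>x. x \<in> F \<Longrightarrow> norm x + 1 - \<epsilon> / 3 \<le> norm (x + e)"
    using thick[unfolded thick_def, rule_format, of F "\<epsilon> / 3"] F(2) \<epsilon>(1) by auto
  have one: "(1 - \<epsilon>) * (norm w + 1) \<le> norm (w + e)" if w: "w \<in> W" for w
  proof (cases "norm w \<le> 2 / \<epsilon>")
    case True
    then have "w \<in> K" using w by (simp add: K_def)
    then obtain x where x: "x \<in> F" "dist x w < \<epsilon> / 3" using F(3) by auto
    have "norm w \<le> norm x + dist x w" "norm (x + e) \<le> norm (w + e) + dist x w"
      using norm_triangle_sub[of w x] norm_triangle_sub[of "x + e" "w + e"]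
      by (simp_all add: dist_norm norm_minus_commute)
    then have "norm w + 1 - \<epsilon> \<le> norm (w + e)" using e(3)[OF x(1)] x(2) by simp
    moreover have "(1 - \<epsilon>) * (norm w + 1) \<le> norm w + 1 - \<epsilon>"
      using \<epsilon> by (simp add: algebra_simps)
    ultimately show ?thesis by simp
  next
    case False
    then have "2 \<le> \<epsilon> * norm w" using \<epsilon>(1) by (simp add: field_simps)
    then have "(1 - \<epsilon>) * (norm w + 1) \<le> norm w - 1" using \<epsilon>(1) by (simp add: algebra_simps)
    also have "\<dots> \<le> norm (w + e)" using norm_diff_ineq[of w e] e(2) by simp
    finally show ?thesis .
  qed
  have "(1 - \<epsilon>) * (norm w + norm c) \<le> norm (w + smul c e)" if w: "w \<in> W" for w c
  proof (cases "c = 0")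
    case True
    then show ?thesis using \<epsilon> by (simp add: mult_left_le_one_le)
  next
    case False
    have "subspace W" using W by (simp add: boundedly_compact_def)
    have "norm c * ((1 - \<epsilon>) * (norm (smul (1 / c) w) + 1)) \<le> norm c * norm (smul (1 / c) w + e)"
      by (intro mult_left_mono one subspace_scale[OF \<open>subspace W\<close> w]) simp
    also have "\<dots> = norm (smul c (smul (1 / c) w + e))" by (simp add: norm_scale)
    also have "smul c (smul (1 / c) w + e) = w + smul c e"
      using False by (simp add: scale_right_distrib)
    also have "norm c * ((1 - \<epsilon>) * (norm (smul (1 / c) w) + 1)) = (1 - \<epsilon>) * (norm w + norm c)"
      using False by (simp add: norm_scale norm_divide field_simps)
    finally show ?thesis .
  qed
  with e(1,2) show thesis by (rule that)
qed

text \<open>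
  Alternate between choosing \<open>e n\<close> for \<open>S n\<close> and enlarging \<open>S n\<close> by \<open>e n\<close> and the next term of the
  given sequence.
\<close>

lemma thick_almost_l1_sequence:
  assumes V: "subspace V" and thick: "thick V" and a: "range a \<subseteq> V"
    and \<epsilon>: "\<And>n. 0 < \<epsilon> n \<and> \<epsilon> n < (1::real)"
  obtains e S where "\<And>n::nat. e n \<in> V" and "\<And>n. norm (e n) \<le> 1"
    and "\<And>n. subspace (S n)" and "incseq S" and "\<And>n. S n \<subseteq> V" and "\<And>n. a n \<in> S n" and "\<And>n. e n \<in> S (Suc n)"
    and "\<And>n w c. w \<in> S n \<Longrightarrow> (1 - \<epsilon> n) * (norm w + norm c) \<le> norm (w + smul c (e n))"
proof -
  define P where "P n x \<longleftrightarrow> (case x of (W, e) \<Rightarrow> boundedly_compact W \<and> W \<subseteq> V \<and> a n \<in> W \<and> e \<in> V \<and> norm e \<le> 1 \<and>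
      (\<forall>w\<in>W. \<forall>c. (1 - \<epsilon> n) * (norm w + norm c) \<le> norm (w + smul c e)))" for n and x :: "'a set \<times> 'a"
  define Q where "Q x y \<longleftrightarrow> fst x \<subseteq> fst y \<and> snd x \<in> fst y" for x y :: "'a set \<times> 'a"
  have extend: "\<exists>W'. boundedly_compact W' \<and> W' \<subseteq> V \<and> W \<subseteq> W' \<and> b \<in> W'"
    if W: "boundedly_compact W" "W \<subseteq> V" "b \<in> V" for W b
  proof -
    obtain W' where "boundedly_compact W'" "W \<subseteq> W'" "b \<in> W'"
      and "\<And>V. subspace V \<Longrightarrow> W \<subseteq> V \<Longrightarrow> b \<in> V \<Longrightarrow> W' \<subseteq> V"
      using boundedly_compact_insert[OF W(1)] by blast
    with V W(2,3) show ?thesis by blast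
  qed
  have choose: "\<exists>e. P n (W, e)" if W: "boundedly_compact W" "W \<subseteq> V" "a n \<in> W" for n W
  proof -
    obtain e where "e \<in> V" "norm e \<le> 1"
      and "\<And>w c. w \<in> W \<Longrightarrow> (1 - \<epsilon> n) * (norm w + norm c) \<le> norm (w + smul c e)"
      using thick_uniform[OF thick W(1,2)] \<epsilon>[of n] by blast
    with W show ?thesis by (auto simp: P_def intro!: exI[of _ e])
  qed
  have aV: "a n \<in> V" for n using a by auto
  have "\<exists>f. \<forall>n. P n (f n) \<and> Q (f n) (f (Suc n))"
  proof (rule dependent_nat_choice)
    have "boundedly_compact {0}" by (auto simp: boundedly_compact_def subspace_single_0 intro: finite_imp_compact)
    then obtain W where "boundedly_compact W" "W \<subseteq> V" "a 0 \<in> W"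
      using extend[of "{0}" "a 0"] subspace_0[OF V] aV by auto
    then show "\<exists>x. P 0 x" using choose by blast
  next
    fix x n assume P: "P n x"
    obtain W e where x: "x = (W, e)" by (cases x)
    from P have W: "boundedly_compact W" "W \<subseteq> V" "e \<in> V" by (auto simp: P_def x)
    obtain W1 where W1: "boundedly_compact W1" "W1 \<subseteq> V" "W \<subseteq> W1" "e \<in> W1"
      using extend[OF W] by blast
    obtain W2 where W2: "boundedly_compact W2" "W2 \<subseteq> V" "W1 \<subseteq> W2" "a (Suc n) \<in> W2"
      using extend[OF W1(1,2) aV] by blast
    obtain e' where "P (Suc n) (W2, e')" using choose[OF W2(1,2,4)] by blast
    moreover have "Q x (W2, e')" using W1 W2 by (auto simp: Q_def x)
    ultimately show "\<exists>y. P (Suc n) y \<and> Q x y" by blast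
  qed
  then obtain f where f: "\<And>n. P n (f n)" "\<And>n. Q (f n) (f (Suc n))" by blast
  define S where "S n = fst (f n)" for n
  define e where "e n = snd (f n)" for n
  have P: "boundedly_compact (S n) \<and> S n \<subseteq> V \<and> a n \<in> S n \<and> e n \<in> V \<and> norm (e n) \<le> 1 \<and>
      (\<forall>w\<in>S n. \<forall>c. (1 - \<epsilon> n) * (norm w + norm c) \<le> norm (w + smul c (e n)))" for n
    using f(1)[of n] by (simp add: P_def S_def e_def case_prod_unfold)
  have Q: "S n \<subseteq> S (Suc n)" "e n \<in> S (Suc n)" for n
    using f(2)[of n] by (simp_all add: Q_def S_def e_def)
  show thesis
  proof (rule that)
    show "incseq S" using Q(1) by (rule incseq_SucI)
  qed (use P Q in \<open>auto simp: boundedly_compact_def\<close>)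
qed

end

context normed_space_over
begin

lemma span_tail:
  assumes "t \<in> span (g ` {N..})"
  obtains M where "N \<le> M" and "t \<in> span (g ` {N..<M::nat})"
proof -
  have "\<exists>M\<ge>N. t \<in> span (g ` {N..<M})"
    using assms
  proof (induction rule: span_induct_alt)
    case base
    show ?case using span_zero by blast
  next
    case (step c x y)
    then obtain n M where n: "x = g n" "N \<le> n" and M: "N \<le> M" "y \<in> span (g ` {N..<M})" by auto
    define L where "L = max M (Suc n)"
    have "x \<in> span (g ` {N..<L})" using n by (auto simp: L_def intro: span_base)
    moreover have "y \<in> span (g ` {N..<L})"
      using M(2) span_mono[OF image_mono, of "{N..<M}" "{N..<L}" g] by (auto simp: L_def)
    ultimately have "smul c x + y \<in> span (g ` {N..<L})" by (intro span_add span_scale)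
    then show ?case using M(1) by (intro exI[of _ L]) (auto simp: L_def)
  qed
  then show thesis using that by blast
qed

text \<open>
  The error factors \<open>q n / q (Suc n)\<close> are chosen to telescope. By induction on \<open>M\<close>, adding a combination of
  the vectors \<open>e n - u n\<close> with \<open>N \<le> n < M\<close> to \<open>x \<in> S N\<close> shrinks the norm at most by the factor
  \<open>q N / q M \<ge> q N\<close>. In the step, almost l1-orthogonality of \<open>e M\<close> yields a gain of \<open>\<parallel>c\<parallel>\<close> that pays for
  subtracting \<open>c (u M)\<close>.
\<close>

lemma tail_distance:
  assumes S: "\<And>n. subspace (S n)" "incseq S"
    and u: "\<And>n. u n \<in> S n" "\<And>n. norm (u n) \<le> 1"
    and e: "\<And>n. e n \<in> S (Suc n)"
    and q: "\<And>n. 0 < q n" "\<And>n. q n \<le> (1::real)"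
    and l1: "\<And>n w c. w \<in> S n \<Longrightarrow> q n / q (Suc n) * (norm w + norm c) \<le> norm (w + smul c (e n))"
    and x: "x \<in> S N"
  shows "q N * norm x \<le> infdist x (span ((\<lambda>n. e n - u n) ` {N..}))"
proof -
  define g where "g n = e n - u n" for n
  have finite_tail: "\<forall>t\<in>span (g ` {N..<M}). x + t \<in> S M \<and> q N * norm x \<le> q M * norm (x + t)"
    if "N \<le> M" for M
    using that
  proof (induction M rule: dec_induct)
    case base
    then show ?case using x by simp
  next
    case (step M)
    show ?case
    proof
      fix t assume "t \<in> span (g ` {N..<Suc M})"
      then have "t \<in> span (insert (g M) (g ` {N..<M}))"
        using step(1) by (simp add: atLeastLessThanSuc)
      then obtain c where c: "t - smul c (g M) \<in> span (g ` {N..<M})"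
        by (auto simp: span_breakdown_eq)
      define y where "y = x + (t - smul c (g M))"
      have y: "y \<in> S M" "q N * norm x \<le> q M * norm y"
        using step(3) c by (auto simp: y_def)
      have w: "y - smul c (u M) \<in> S M"
        by (intro subspace_diff subspace_scale S(1) u(1) y(1))
      have xt: "x + t = (y - smul c (u M)) + smul c (e M)"
        by (simp add: y_def g_def scale_right_diff_distrib)
      have "S M \<subseteq> S (Suc M)" using S(2) by (simp add: incseq_SucD)
      then have "x + t \<in> S (Suc M)"
        unfolding xt using w by (intro subspace_add subspace_scale S(1) e) auto
      moreover have "q N * norm x \<le> q (Suc M) * norm (x + t)"
      proof -
        have "norm (smul c (u M)) \<le> norm c" using u(2)[of M] by (simp add: norm_scale mult_left_le)
        then have "norm y \<le> norm (y - smul c (u M)) + norm c"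
          using norm_triangle_sub[of y "smul c (u M)"] by simp
        then have "q M / q (Suc M) * norm y \<le> q M / q (Suc M) * (norm (y - smul c (u M)) + norm c)"
          using q(1)[of M] q(1)[of "Suc M"] by (intro mult_left_mono) auto
        also have "\<dots> \<le> norm (x + t)" unfolding xt by (rule l1[OF w])
        finally have "q M * norm y \<le> q (Suc M) * norm (x + t)"
          using q(1)[of "Suc M"] by (simp add: field_simps)
        with y(2) show ?thesis by simp
      qed
      ultimately show "x + t \<in> S (Suc M) \<and> q N * norm x \<le> q (Suc M) * norm (x + t)" by blast
    qed
  qed
  have le: "q N * norm x \<le> norm (x + t)" if t: "t \<in> span (g ` {N..})" for t
  proof -
    obtain M where "N \<le> M" "t \<in> span (g ` {N..<M})" using span_tail[OF t] by blast
    then have "q N * norm x \<le> q M * norm (x + t)" using finite_tail by blast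
    also have "\<dots> \<le> norm (x + t)" using q(1)[of M] q(2)[of M] by (intro mult_left_le_one_le) auto
    finally show ?thesis .
  qed
  have "q N * norm x \<le> (INF t\<in>span (g ` {N..}). dist x t)"
  proof (rule cINF_greatest)
    show "span (g ` {N..}) \<noteq> {}" using span_zero by blast
    fix t assume "t \<in> span (g ` {N..})"
    then show "q N * norm x \<le> dist x t" using le[of "- t"] by (simp add: span_neg dist_norm)
  qed
  moreover have "span (g ` {N..}) \<noteq> {}" using span_zero by blast
  ultimately show ?thesis by (simp add: infdist_notempty g_def)
qed

end

section \<open>From thickness to the almost Daugavet property\<close>

text \<open>
  A dense sequence of the whole space may miss \<open>V\<close>. Instead, pick for each of its points \<open>c\<close> and each \<open>n\<close> some
  point of \<open>V\<close> within \<open>1 / Suc n\<close> of \<open>c\<close>, if there is one.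
\<close>

lemma separable_subset_dense_sequence:
  fixes V :: "'a::metric_space set"
  assumes "separable_space (euclidean :: 'a topology)" and "V \<noteq> {}"
  obtains d :: "nat \<Rightarrow> 'a" where "range d \<subseteq> V" and "\<And>x r. x \<in> V \<Longrightarrow> 0 < r \<Longrightarrow> \<exists>i. dist x (d i) < r"
proof -
  obtain C :: "'a set" where C: "countable C" "closure C = UNIV"
    using assms(1) by (auto simp: separable_space_def)
  obtain v where v: "v \<in> V" using assms(2) by auto
  define g where "g = (\<lambda>(c, n::nat). if \<exists>y\<in>V. dist y c < 1 / Suc n then SOME y. y \<in> V \<and> dist y c < 1 / Suc n else v)"
  define D where "D = g ` (C \<times> UNIV)"
  have g: "g (c, n) \<in> V \<and> dist (g (c, n)) c < 1 / Suc n" if "y \<in> V" "dist y c < 1 / Suc n" for y c n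
    using someI[of "\<lambda>y. y \<in> V \<and> dist y c < 1 / Suc n" y] that by (auto simp: g_def)
  have "g (c, n) \<in> V" for c n
  proof (cases "\<exists>y\<in>V. dist y c < 1 / Suc n")
    case True
    then show ?thesis using g by blast
  next
    case False
    then show ?thesis using v by (simp add: g_def)
  qed
  then have D_sub: "D \<subseteq> V" by (auto simp: D_def)
  have "C \<noteq> {}" using C(2) by auto
  then have "D \<noteq> {}" by (auto simp: D_def)
  moreover have "countable D" using C(1) by (auto simp: D_def)
  ultimately have range: "range (from_nat_into D) = D" by (rule range_from_nat_into)
  show thesis
  proof (rule that)
    show "range (from_nat_into D) \<subseteq> V" using range D_sub by simp
    fix x and r :: real assume x: "x \<in> V" "0 < r"
    obtain n where n: "1 / Suc n < r / 2" using x(2) nat_approx_posE[of "r / 2"] by auto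
    obtain c where c: "c \<in> C" "dist c x < 1 / Suc n"
      using C(2) closure_approachable[of x C] by (metis UNIV_I of_nat_0_less_iff zero_less_Suc zero_less_divide_1_iff)
    have "dist (g (c, n)) c < 1 / Suc n" using g[of x c n] x(1) c(2) by (simp add: dist_commute)
    then have "dist x (g (c, n)) < r"
      using c(2) n dist_triangle[of x "g (c, n)" c] by (simp add: dist_commute)
    moreover have "g (c, n) \<in> range (from_nat_into D)" unfolding range using c(1) by (auto simp: D_def)
    ultimately show "\<exists>i. dist x (from_nat_into D i) < r" by auto
  qed
qed

context hahn_banach_space
begin

text \<open>
  The space of functionals that realizes the almost Daugavet property is
  \<open>Y = {f. f (e n) = f (u n) for almost all n}\<close>, as explained at the beginning. The sequence \<open>u\<close> enumerates
  the normalized terms of a dense sequence, each infinitely often, by means of a pairing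
  function; \<open>u n\<close> is in \<open>S n\<close> because the code of a pair is at least as large as its components.
\<close>

theorem separable_thick_imp_almost_daugavet:
  assumes V: "subspace V" and thick: "thick V"
    and separable: "separable_space (euclidean :: 'a topology)"
  shows "almost_daugavet smul V"
proof -
  obtain d :: "nat \<Rightarrow> 'a" where d: "range d \<subseteq> V"
    and dense: "\<And>x r. x \<in> V \<Longrightarrow> 0 < r \<Longrightarrow> \<exists>i. dist x (d i) < r"
    using separable_subset_dense_sequence[OF separable, of V] subspace_0[OF V] by blast
  \<comment> \<open>Any strictly increasing sequence of positive numbers with limit 1 would serve.\<close>
  define q where "q n = 1 - 1 / real (n + 2)" for n
  have q: "0 < q n" "q n \<le> 1" "q n < q (Suc n)" for n
    by (auto simp: q_def field_simps)
  have "0 < 1 - q n / q (Suc n) \<and> 1 - q n / q (Suc n) < 1" for n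
    using q[of n] q(1)[of "Suc n"] by (simp add: field_simps)
  then obtain e S where e: "\<And>n::nat. e n \<in> V" "\<And>n. norm (e n) \<le> 1"
    and S: "\<And>n. subspace (S n)" "incseq S" "\<And>n. S n \<subseteq> V" "\<And>n. d n \<in> S n"
    and e_S: "\<And>n. e n \<in> S (Suc n)"
    and l1': "\<And>n w c. w \<in> S n \<Longrightarrow>
      (1 - (1 - q n / q (Suc n))) * (norm w + norm c) \<le> norm (w + smul c (e n))"
    using thick_almost_l1_sequence[OF V thick d, of "\<lambda>n. 1 - q n / q (Suc n)"] by blast
  have l1: "q n / q (Suc n) * (norm w + norm c) \<le> norm (w + smul c (e n))" if "w \<in> S n" for n w c
    using l1'[OF that, of c] by simp
  have d_S: "d i \<in> S n" if "i \<le> n" for i n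
    using S(4)[of i] incseqD[OF S(2) that] by auto
  define u where "u n = sgn (d (fst (prod_decode n)))" for n
  have fst_le: "fst (prod_decode n) \<le> n" for n
    using le_prod_encode_1[of "fst (prod_decode n)" "snd (prod_decode n)"] by simp
  have sgn_scale: "sgn x = smul (of_real (inverse (norm x))) x" for x
    by (simp only: sgn_div_norm scale_of_real)
  have u_S: "u n \<in> S n" for n
    unfolding u_def sgn_scale by (intro subspace_scale S(1) d_S fst_le)
  have u_le: "norm (u n) \<le> 1" for n by (simp add: u_def norm_sgn)
  have u_often: "\<exists>n\<ge>N. u n = sgn (d i)" for i N
    using le_prod_encode_2[of N i] by (intro exI[of _ "prod_encode (i, N)"]) (simp add: u_def)
  \<comment> \<open>On all of \<open>V\<close>, the sequence \<open>e\<close> is asymptotically l1-orthogonal, although the estimates for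
    the \<open>S n\<close> only cover a dense subspace.\<close>
  have asymptotic: "\<forall>\<^sub>F n in sequentially. norm y + 1 - \<delta> < norm (y + e n)"
    if y: "y \<in> V" and \<delta>: "0 < \<delta>" for y \<delta>
  proof -
    obtain i where i: "dist y (d i) < \<delta> / 3" using dense[OF y, of "\<delta> / 3"] \<delta> by auto
    have "(\<lambda>n. q n * (norm (d i) + 1)) \<longlonglongrightarrow> (1 - 0) * (norm (d i) + 1)"
      unfolding q_def using LIMSEQ_ignore_initial_segment[OF lim_1_over_n, of 2]
      by (intro tendsto_intros) auto
    then have "\<forall>\<^sub>F n in sequentially. norm (d i) + 1 - \<delta> / 3 < q n * (norm (d i) + 1)"
      using \<delta> by (intro order_tendstoD(1)) auto
    then show ?thesis
      using eventually_ge_at_top[of i]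
    proof eventually_elim
      case (elim n)
      have "q n * (norm (d i) + 1) \<le> q n / q (Suc n) * (norm (d i) + 1)"
        using q(1)[of n] q(1)[of "Suc n"] q(2)[of "Suc n"] by (intro mult_right_mono) (auto simp: field_simps)
      also have "\<dots> \<le> norm (d i + e n)" using l1[OF d_S[OF elim(2)], of 1] by simp
      finally have "norm (d i) + 1 - \<delta> / 3 < norm (d i + e n)" using elim(1) by simp
      moreover have "norm (d i + e n) \<le> norm (y + e n) + dist y (d i)" "norm y \<le> norm (d i) + dist y (d i)"
        using norm_triangle_sub[of "d i + e n" "y + e n"] norm_triangle_sub[of y "d i"]
        by (simp_all add: dist_norm norm_minus_commute)
      ultimately show ?case using i by simp
    qed
  qed
  define Y where "Y = {f \<in> dual_on smul V. \<forall>\<^sub>F n in sequentially. f (e n) = f (u n)}"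
  have subspace_Y: "dual_subspace smul V Y"
    unfolding dual_subspace_def
  proof (intro conjI ballI allI)
    fix f g assume "f \<in> Y" "g \<in> Y"
    then show "(\<lambda>x. f x + g x) \<in> Y"
      by (auto simp: Y_def dual_on_add elim: eventually_elim2)
  next
    fix c f assume "f \<in> Y"
    then show "(\<lambda>x. c * f x) \<in> Y"
      by (auto simp: Y_def dual_on_scale elim: eventually_mono)
  qed (auto simp: Y_def dual_on_zero)
  \<comment> \<open>Approximate \<open>x\<close> by some \<open>d i\<close>, and take a functional that vanishes on a late tail span and is
    almost \<open>\<parallel>d i\<parallel>\<close> at \<open>d i\<close>. Its norm \<open>s\<close> may be below 1; normalizing it only increases the values.\<close>
  have approx: "\<exists>f\<in>Y. onorm_on V f = 1 \<and> norm x - \<delta> \<le> norm (f x)"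
    if x: "x \<in> V" "x \<noteq> 0" and \<delta>: "0 < \<delta>" for x \<delta>
  proof -
    have "0 < min (\<delta> / 3) (norm x)" using x(2) \<delta> by simp
    then obtain i where i: "dist x (d i) < min (\<delta> / 3) (norm x)" using dense[OF x(1)] by blast
    have di: "d i \<in> V" using d by auto
    have tri: "norm x \<le> norm (d i) + dist x (d i)" "norm (d i) \<le> norm x + dist x (d i)"
      using norm_triangle_sub[of x "d i"] norm_triangle_sub[of "d i" x]
      by (simp_all add: dist_norm norm_minus_commute)
    have "0 < norm (d i)" using tri(1) i by linarith
    \<comment> \<open>This makes \<open>(1 - q N) \<parallel>d i\<parallel> \<le> 2 \<parallel>x\<parallel> / (N + 2) \<le> \<delta> / 3\<close>.\<close>
    obtain N0 :: nat where N0: "6 * norm x / \<delta> < real N0" using reals_Archimedean2 by blast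
    define N where "N = max i N0"
    have "6 * norm x / \<delta> < real N" using N0 by (simp add: N_def)
    then have "6 * norm x < \<delta> * real (N + 2)" using \<delta> by (simp add: field_simps)
    then have "2 * norm x / real (N + 2) \<le> \<delta> / 3" by (simp add: field_simps)
    moreover have "norm (d i) / real (N + 2) \<le> 2 * norm x / real (N + 2)"
      using tri(2) i by (intro divide_right_mono) auto
    moreover have "norm (d i) - q N * norm (d i) = norm (d i) / real (N + 2)"
      by (simp add: q_def algebra_simps)
    ultimately have qN: "norm (d i) - \<delta> / 3 \<le> q N * norm (d i)" by linarith
    define T where "T = span ((\<lambda>n. e n - u n) ` {N..})"
    have "subspace T" by (simp add: T_def subspace_span)
    then obtain f where f: "f \<in> dual_on smul V" "\<And>z. z \<in> V \<Longrightarrow> norm (f z) \<le> norm z"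
      "\<And>t. t \<in> T \<Longrightarrow> f t = 0" and f_di: "norm (f (d i)) = infdist (d i) T"
      using annihilating_functional[OF _ V, of T "d i"] di by metis
    have f_ge: "q N * norm (d i) \<le> norm (f (d i))"
      unfolding f_di T_def by (rule tail_distance[OF S(1,2) u_S u_le e_S q(1,2) l1 d_S]) (auto simp: N_def)
    define s where "s = onorm_on V f"
    have "s \<le> 1" unfolding s_def using f(2) subspace_0[OF V] by (intro onorm_on_le) auto
    have "0 < q N * norm (d i)" using q(1) \<open>0 < norm (d i)\<close> by simp
    also have "\<dots> \<le> s * norm (d i)" unfolding s_def using f_ge dual_onD(3)[OF f(1) di] by simp
    finally have "0 < s" using \<open>0 < norm (d i)\<close> by (simp add: zero_less_mult_iff)
    have "f (e n) = f (u n)" if "N \<le> n" for n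
    proof -
      have "e n - u n \<in> T" unfolding T_def using that by (intro span_base) auto
      then have "f (e n - u n) = 0" by (rule f(3))
      moreover have un: "u n \<in> V" using u_S S(3) by blast
      moreover have "f (u n + (e n - u n)) = f (u n) + f (e n - u n)"
        by (rule dual_onD(1)[OF f(1) un subspace_diff[OF V e(1) un]])
      ultimately show ?thesis by simp
    qed
    then have "f \<in> Y" using f(1) by (auto simp: Y_def eventually_sequentially)
    then have "(\<lambda>z. of_real (1 / s) * f z) \<in> Y" using subspace_Y unfolding dual_subspace_def by blast
    moreover have "onorm_on V (\<lambda>z. of_real (1 / s) * f z) = 1"
      using onorm_on_scale[OF f(1) V, of "of_real (1 / s)"] \<open>0 < s\<close> by (simp add: s_def norm_divide)
    moreover have "norm x - \<delta> \<le> norm (of_real (1 / s) * f x)"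
    proof -
      have "f (x + (d i - x)) = f x + f (d i - x)"
        by (rule dual_onD(1)[OF f(1) x(1) subspace_diff[OF V di x(1)]])
      then have "norm (f (d i)) \<le> norm (f x) + norm (f (d i - x))" by (simp add: norm_triangle_ineq)
      moreover have "norm (f (d i - x)) \<le> dist x (d i)"
        using f(2)[OF subspace_diff[OF V di x(1)]] by (simp add: dist_norm norm_minus_commute)
      ultimately have "norm x - \<delta> \<le> norm (f x)" using f_ge qN tri(1) i by simp
      also have "norm (f x) \<le> norm (f x) / s"
        using \<open>0 < s\<close> \<open>s \<le> 1\<close> by (simp add: le_divide_eq mult_left_le)
      finally show ?thesis using \<open>0 < s\<close> by (simp add: norm_mult norm_divide)
    qed
    ultimately show ?thesis by (intro bexI[of _ "\<lambda>z. of_real (1 / s) * f z"]) auto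
  qed
  have norming: "norming_on V Y"
    unfolding norming_on_def
  proof (intro ballI antisym)
    fix x assume x: "x \<in> V"
    show "(SUP f\<in>{f\<in>Y. onorm_on V f = 1}. ennreal (norm (f x))) \<le> ennreal (norm x)"
    proof (rule SUP_least)
      fix f assume "f \<in> {f\<in>Y. onorm_on V f = 1}"
      then show "ennreal (norm (f x)) \<le> ennreal (norm x)"
        using dual_onD(3)[of f V x] x by (intro ennreal_leI) (auto simp: Y_def)
    qed
    show "ennreal (norm x) \<le> (SUP f\<in>{f\<in>Y. onorm_on V f = 1}. ennreal (norm (f x)))"
    proof (cases "x = 0")
      case False
      show ?thesis
      proof (rule ennreal_le_epsilon)
        fix \<delta> :: real assume "0 < \<delta>"
        then obtain f where f: "f \<in> Y" "onorm_on V f = 1" "norm x - \<delta> \<le> norm (f x)"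
          using approx[OF x False] by blast
        have "ennreal (norm x) \<le> ennreal (norm (f x) + \<delta>)" using f(3) by (intro ennreal_leI) simp
        also have "\<dots> = ennreal (norm (f x)) + ennreal \<delta>"
          using \<open>0 < \<delta>\<close> by (simp add: ennreal_plus)
        also have "\<dots> \<le> (SUP f\<in>{f\<in>Y. onorm_on V f = 1}. ennreal (norm (f x))) + ennreal \<delta>"
          using f by (intro add_right_mono SUP_upper) auto
        finally show "ennreal (norm x) \<le> (SUP f\<in>{f\<in>Y. onorm_on V f = 1}. ennreal (norm (f x))) + ennreal \<delta>" .
      qed
    qed simp
  qed
  have "daugavet_wrt smul V Y"
    unfolding daugavet_wrt_def
  proof (intro ballI)
    fix x f assume x: "x \<in> V" and "f \<in> Y"
    then have f: "f \<in> dual_on smul V" and ev: "\<forall>\<^sub>F n in sequentially. f (e n) = f (u n)"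
      by (auto simp: Y_def)
    define R where "R = onorm_on V (\<lambda>z. z + smul (f z) x)"
    note id_bound = norm_id_plus_rank_one_le[OF f, of _ x]
    \<comment> \<open>Evaluate at \<open>e n\<close> for a late \<open>n\<close> with \<open>u n = sgn (d i)\<close>. Since \<open>e n\<close> has norm at most 1,
      normalizing it only helps.\<close>
    have ge: "norm (smul (f (sgn (d i))) x) + 1 \<le> R" for i
    proof (rule field_le_epsilon)
      fix \<delta> :: real assume \<delta>: "0 < \<delta>"
      define y where "y = smul (f (sgn (d i))) x"
      have y: "y \<in> V" unfolding y_def by (rule subspace_scale[OF V x])
      have "\<forall>\<^sub>F n in sequentially. f (e n) = f (u n) \<and> norm y + 1 - \<delta> < norm (y + e n) \<and> norm (0::'a) + 1 - 1 < norm (0 + e n)"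
        using ev asymptotic[OF y \<delta>] asymptotic[OF subspace_0[OF V], of 1] by (simp add: eventually_conj_iff)
      then obtain N where N: "\<And>n. N \<le> n \<Longrightarrow> f (e n) = f (u n) \<and> norm y + 1 - \<delta> < norm (y + e n) \<and> e n \<noteq> 0"
        by (auto simp: eventually_sequentially)
      obtain n where n: "N \<le> n" "u n = sgn (d i)" using u_often by blast
      have "norm y + 1 - \<delta> \<le> norm (e n + smul (f (e n)) x)"
        using N[OF n(1)] n(2) by (simp add: y_def add.commute)
      also have "\<dots> \<le> norm (e n + smul (f (e n)) x) / norm (e n)"
        using N[OF n(1)] e(2)[of n] by (simp add: le_divide_eq mult_left_le)
      also have "\<dots> \<le> R" unfolding R_def by (rule onorm_on_ge[OF id_bound e(1)])
      finally show "norm (smul (f (sgn (d i))) x) + 1 \<le> R + \<delta>" by (simp add: y_def)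
    qed
    have "R \<le> 1 + onorm_on V f * norm x"
      unfolding R_def using subspace_0[OF V] dual_on_onorm_nonneg[OF f V] id_bound
      by (intro onorm_on_le) auto
    moreover have "1 + onorm_on V f * norm x \<le> R"
    proof (cases "x = 0")
      case True
      then show ?thesis using ge[of 0] by simp
    next
      case False
      have "1 \<le> R" using ge[of 0] norm_ge_zero[of "smul (f (sgn (d 0))) x"] by linarith
      have "onorm_on V f \<le> (R - 1) / norm x"
      proof (rule onorm_on_le_dense[OF f V _ d dense])
        show "0 \<le> (R - 1) / norm x" using \<open>1 \<le> R\<close> by simp
        fix i
        show "norm (f (d i)) \<le> (R - 1) / norm x * norm (d i)"
        proof (cases "d i = 0")
          case True
          then show ?thesis using dual_onD(3)[OF f subspace_0[OF V]] by simp
        next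
          case dn: False
          have "f (sgn (d i)) = of_real (inverse (norm (d i))) * f (d i)"
            unfolding sgn_scale using d by (intro dual_onD(2)[OF f]) auto
          then have "norm (smul (f (sgn (d i))) x) = norm (f (d i)) / norm (d i) * norm x"
            by (simp add: norm_scale norm_mult norm_inverse divide_inverse mult.commute)
          then have "norm (f (d i)) / norm (d i) * norm x \<le> R - 1" using ge[of i] by simp
          then show ?thesis using False dn by (simp add: field_simps)
        qed
      qed auto
      then show ?thesis using False by (simp add: field_simps)
    qed
    ultimately have "R = 1 + onorm_on V f * norm x" by simp
    then show "onorm_on V (\<lambda>z. z + smul (f z) x) = 1 + onorm_on V (\<lambda>z. smul (f z) x)"
      by (simp add: R_def onorm_on_rank_one[OF f V])
  qed
  with subspace_Y norming show ?thesis by (auto simp: almost_daugavet_def)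
qed

theorem almost_daugavet_L_summand:
  assumes separable: "separable_space (euclidean :: 'a topology)"
    and X: "almost_daugavet smul UNIV" and L: "L_decomposition smul J J'"
  shows "almost_daugavet smul J \<or> almost_daugavet smul J'"
proof -
  have "thick UNIV" by (rule almost_daugavet_imp_thick[OF subspace_UNIV X])
  then have "thick J \<or> thick J'" by (rule thick_L_summand[OF L])
  moreover have "subspace J" "subspace J'" using L by (simp_all add: L_decomposition_def)
  ultimately show ?thesis using separable_thick_imp_almost_daugavet[OF _ _ separable] by blast
qed

end

theorem proposition2p3:
  fixes J J' :: "'a::banach set"
    and smulC :: "complex \<Rightarrow> 'a \<Rightarrow> 'a"
  assumes "separable_space (euclidean :: 'a topology)"
  shows "(almost_daugavet (scaleR :: real \<Rightarrow> 'a \<Rightarrow> 'a) UNIV \<and>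
          L_decomposition (scaleR :: real \<Rightarrow> 'a \<Rightarrow> 'a) J J' \<longrightarrow>
            almost_daugavet (scaleR :: real \<Rightarrow> 'a \<Rightarrow> 'a) J \<or>
            almost_daugavet (scaleR :: real \<Rightarrow> 'a \<Rightarrow> 'a) J') \<and>
         (normed_space_over smulC \<and>
          almost_daugavet smulC UNIV \<and>
          L_decomposition smulC J J' \<longrightarrow>
            almost_daugavet smulC J \<or> almost_daugavet smulC J')"
  using hahn_banach_space.almost_daugavet_L_summand[OF hahn_banach_space_scaleR assms, of J J']
    hahn_banach_space.almost_daugavet_L_summand[OF hahn_banach_space_complex assms, of smulC J J']
  by blast

end
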